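(* Let $a>0$ and let $q:\mathbb{R}\to\mathbb{R}$ be a real potential with $\int_{\mathbb{R}}|q(x)|^2e^{2a|x|}\,dx<\infty$. Let $\Omega_0=\{\lambda=\alpha+i\beta:\ \alpha,\beta\in\mathbb{R},\ |\alpha|<\sqrt3\,\beta\}$, let $\psi_0(\lambda,x)$ be the solution of the integral equation $$\psi_0(\lambda,x)=1-i\int_x^\infty e^{i\lambda\zeta_0(t-x)}\frac{s_2(i\lambda(x-t))}{(i\lambda)^2}q(t)\psi_0(\lambda,t)\,dt ,$$ and let $v_0(\lambda,x)=\psi_0(\lambda,x)e^{i\lambda\zeta_0x}$. Then for each $x\in\mathbb{R}$ the function $\psi_0(\lambda,x)$ is analytic in $\lambda$ in the sector $\Omega_0$, and for $\lambda\in\Omega_0$ (a) $\psi_0(\lambda,x)=1+\dfrac{i}{3\lambda^2}\displaystyle\int_x^\infty q(t)\,dt+C_0(\lambda,x)+D_0(\lambda,x)$; (b) $v_0'(\lambda,x)e^{-i\lambda\zeta_0x}=i\lambda\zeta_0-\dfrac1{3\lambda}\displaystyle\int_x^\infty q(t)\,dt+C_1(\lambda,x)+D_1(\lambda,x)$; (c) $v_0''(\lambda,x)e^{-i\lambda\zeta_0x}=(i\lambda\zeta_0)^2-\dfrac i3\displaystyle\int_x^\infty q(t)\,dt+C_2(\lambda,x)+D_2(\lambda,x)$, where the functions $C_k$, $D_k$ ($0\le k\le2$) satisfy, for $\lambda\in\Omega_0$ with $|\lambda|\gg1$, so large that $r(\lambda)<1$, $$|C_k(\lambda,x)|<|\lambda|^k\,r^2(\lambda)(1-r(\lambda))^{-1},\qquad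 |D_k(\lambda,x)|<q_2|\lambda|^{k-2}\delta(\lambda).$$ Here $r(\lambda)=q_1/|\lambda|^2$, $q_s=\|q\|_{L^s(\mathbb{R})}$ ($s=1,2$), and $\delta(\lambda)=(\beta\sqrt3-|\alpha|)^{-1/2}$ for $\lambda=\alpha+i\beta\in\Omega_0$.
   Context: Primes on $v_0$ denote derivatives in $x$. $\zeta_0=1$, $\zeta_1=\frac12(-1+i\sqrt3)$, $\zeta_2=\frac12(-1-i\sqrt3)$ are the cube roots of unity and $s_2(z)=\frac13\sum_{k=0}^2\zeta_k^{-2}e^{\zeta_kz}$. The solution $\psi_0$ is the one obtained by successive approximations. The condition on $q$ implies $q\in L^1(\mathbb{R})\cap L^2(\mathbb{R})$. The function $v_0$ is a Jost solution of $iy'''+qy=\lambda^3y$. The functions $C_0,D_0$ are $$C_0(\lambda,x)=\frac i{3\lambda^2}\int_x^\infty\left(1+\zeta_1e^{i\lambda(\zeta_0-\zeta_1)(t-x)}+\zeta_2e^{i\lambda(\zeta_0-\zeta_2)(t-x)}\right)q(t)(\psi_0(\lambda,t)-1)\,dt,$$ $$D_0(\lambda,x)=\frac i{3\lambda^2}\int_x^\infty\left(\zeta_1e^{i\lambda(\zeta_0-\zeta_1)(t-x)}+\zeta_2e^{i\lambda(\zeta_0-\zeta_2)(t-x)}\right)q(t)\,dt;$$ for $k=1,2$, $C_k$ and $D_k$ denote remainder functions in (b), (c) for which the stated estimates hold.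
   Formalization: The strict estimates for C_k and D_k are claimed only when q is not zero almost everywhere (for q = 0 they would read 0 < 0); for all q the non-strict estimates are proved. *)

theory Defs
  imports "HOL-Analysis.Analysis"
begin

definition zeta :: "nat \<Rightarrow> complex" where
  "zeta k = (if k = 0 then 1
             else if k = 1 then (- 1 + \<i> * sqrt 3) / 2
             else (- 1 - \<i> * sqrt 3) / 2)"

definition s2 :: "complex \<Rightarrow> complex" where
  "s2 z = (\<Sum>k\<in>{0..2}. zeta k powi (- 2) * exp (zeta k * z)) / 3"

definition Omega0 :: "complex set" where
  "Omega0 = {l. \<bar>Re l\<bar> < sqrt 3 * Im l}"

definition psi_integrand ::
    "(real \<Rightarrow> real) \<Rightarrow> complex \<Rightarrow> (real \<Rightarrow> complex) \<Rightarrow> real \<Rightarrow> real \<Rightarrow> complex" where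
  "psi_integrand q l f x t =
     exp (\<i> * l * zeta 0 * of_real (t - x)) * (s2 (\<i> * l * of_real (x - t)) / (\<i> * l)\<^sup>2)
       * of_real (q t) * f t"

definition psi_map ::
    "(real \<Rightarrow> real) \<Rightarrow> complex \<Rightarrow> (real \<Rightarrow> complex) \<Rightarrow> real \<Rightarrow> complex" where
  "psi_map q l f x = 1 - \<i> * (LINT t:{x..}|lebesgue. psi_integrand q l f x t)"

text \<open>The Bochner integral of a non-integrable function is \<open>0\<close> by convention, so integrability
  is part of being a solution.\<close>

definition solves_psi_equation ::
    "(real \<Rightarrow> real) \<Rightarrow> complex \<Rightarrow> (real \<Rightarrow> complex) \<Rightarrow> bool" where
  "solves_psi_equation q l f \<longleftrightarrow>
     (\<forall>x. set_integrable lebesgue {x..} (psi_integrand q l f x) \<and> f x = psi_map q l f x)"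

primrec psi_approx :: "(real \<Rightarrow> real) \<Rightarrow> complex \<Rightarrow> nat \<Rightarrow> real \<Rightarrow> complex" where
  "psi_approx q l 0 = (\<lambda>x. 1)"
| "psi_approx q l (Suc n) = psi_map q l (psi_approx q l n)"

definition psi0 :: "(real \<Rightarrow> real) \<Rightarrow> complex \<Rightarrow> real \<Rightarrow> complex" where
  "psi0 q l x = lim (\<lambda>n. psi_approx q l n x)"

definition v0 :: "(real \<Rightarrow> real) \<Rightarrow> complex \<Rightarrow> real \<Rightarrow> complex" where
  "v0 q l x = psi0 q l x * exp (\<i> * l * zeta 0 * of_real x)"

text \<open>Derivatives in the real variable \<open>x\<close>.\<close>

definition v0' :: "(real \<Rightarrow> real) \<Rightarrow> complex \<Rightarrow> real \<Rightarrow> complex" where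
  "v0' q l x = vector_derivative (v0 q l) (at x)"

definition v0'' :: "(real \<Rightarrow> real) \<Rightarrow> complex \<Rightarrow> real \<Rightarrow> complex" where
  "v0'' q l x = vector_derivative (v0' q l) (at x)"

definition C0 :: "(real \<Rightarrow> real) \<Rightarrow> complex \<Rightarrow> real \<Rightarrow> complex" where
  "C0 q l x = \<i> / (3 * l\<^sup>2) *
     (LINT t:{x..}|lebesgue.
        (1 + zeta 1 * exp (\<i> * l * (zeta 0 - zeta 1) * of_real (t - x))
           + zeta 2 * exp (\<i> * l * (zeta 0 - zeta 2) * of_real (t - x)))
        * of_real (q t) * (psi0 q l t - 1))"

definition D0 :: "(real \<Rightarrow> real) \<Rightarrow> complex \<Rightarrow> real \<Rightarrow> complex" where
  "D0 q l x = \<i> / (3 * l\<^sup>2) *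
     (LINT t:{x..}|lebesgue.
        (zeta 1 * exp (\<i> * l * (zeta 0 - zeta 1) * of_real (t - x))
           + zeta 2 * exp (\<i> * l * (zeta 0 - zeta 2) * of_real (t - x)))
        * of_real (q t))"

definition Lnorm :: "real \<Rightarrow> (real \<Rightarrow> real) \<Rightarrow> real" where
  "Lnorm s q = (LINT x|lebesgue. \<bar>q x\<bar> powr s) powr (1 / s)"

definition r :: "(real \<Rightarrow> real) \<Rightarrow> complex \<Rightarrow> real" where
  "r q l = Lnorm 1 q / (norm l)\<^sup>2"

definition delta :: "complex \<Rightarrow> real" where
  "delta l = (Im l * sqrt 3 - \<bar>Re l\<bar>) powr (- (1 / 2))"

end

theory Submission
  imports Defs "HOL-Complex_Analysis.Cauchy_Integral_Formula"
begin

text \<open>Since \<open>\<zeta>\<^sub>k\<^sup>-\<^sup>2 = \<zeta>\<^sub>k\<close>, the kernel of the integral equation is a combination of the exponentials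
  \<open>exp (i \<lambda> (1 - \<zeta>\<^sub>k) (t - x))\<close>, which have modulus at most \<open>1\<close> for \<open>t \<ge> x\<close> and \<open>\<lambda>\<close> in the sector.
  With \<open>Q(x)\<close> the integral of \<open>\<bar>q\<bar>\<close> over \<open>[x, \<infinity>)\<close>, the successive approximations differ by at most
  \<open>(Q(x) / \<bar>\<lambda>\<bar>\<^sup>2)\<^sup>n / n!\<close>. They therefore converge, uniformly for \<open>\<lambda>\<close> bounded away from \<open>0\<close>, to a solution
  that is analytic in \<open>\<lambda>\<close> and satisfies \<open>\<bar>\<psi>\<^sub>0 - 1\<bar> \<le> exp r - 1 < r / (1 - r)\<close>.
  As \<open>1 + \<zeta>\<^sub>1 + \<zeta>\<^sub>2 = 0\<close>, the kernel and its first \<open>x\<close>-derivative vanish on the diagonal, so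
  the integral may be differentiated twice, everywhere, although \<open>q\<close> is only integrable.
  Each derivative multiplies the \<open>k\<close>-th exponential by \<open>i \<lambda> \<zeta>\<^sub>k\<close>. Writing \<open>q \<psi>\<^sub>0 = q + q (\<psi>\<^sub>0 - 1)\<close> separates
  the leading term, \<open>D\<^sub>k\<close> (estimated by Cauchy--Schwarz) and \<open>C\<^sub>k\<close>.\<close>

section \<open>Parameter integrals\<close>

text \<open>First countability lets the limit be tested along sequences, which reduces it to
  dominated convergence for sequences. A sequence meets only countably many parameters, so the null
  set of the bound may depend on \<open>x\<close>.\<close>

lemma tendsto_integral_dominated_within:
  fixes G :: "'x::first_countable_topology \<Rightarrow> 'a \<Rightarrow> 'b::{banach, second_countable_topology}"
  assumes "G0 \<in> borel_measurable M"
    and "\<And>x. x \<in> S \<Longrightarrow> x \<noteq> x0 \<Longrightarrow> G x \<in> borel_measurable M"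
    and "integrable M w"
    and lim: "AE t in M. ((\<lambda>x. G x t) \<longlongrightarrow> G0 t) (at x0 within S)"
    and "\<And>x. x \<in> S \<Longrightarrow> x \<noteq> x0 \<Longrightarrow> AE t in M. norm (G x t) \<le> w t"
  shows "((\<lambda>x. integral\<^sup>L M (G x)) \<longlongrightarrow> integral\<^sup>L M G0) (at x0 within S)"
  unfolding tendsto_at_iff_sequentially o_def
proof (intro allI impI)
  fix X :: "nat \<Rightarrow> 'x"
  assume X: "\<forall>i. X i \<in> S - {x0}" "X \<longlonglongrightarrow> x0"
  have "AE t in M. (\<lambda>i. G (X i) t) \<longlonglongrightarrow> G0 t"
    using lim by eventually_elim (use X in \<open>auto simp: tendsto_at_iff_sequentially o_def\<close>)
  then show "(\<lambda>i. integral\<^sup>L M (G (X i))) \<longlonglongrightarrow> integral\<^sup>L M G0"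
    using X assms by (intro integral_dominated_convergence[where w = w]) auto
qed

text \<open>A local majorant of \<open>F\<close> itself suffices: Cauchy's inequality turns it into
  a majorant of the complex derivative on a smaller disc, hence of the difference quotients, and
  dominated convergence applies to these.\<close>

lemma holomorphic_on_lebesgue_integral:
  fixes F :: "complex \<Rightarrow> 'a \<Rightarrow> complex"
  assumes "open S"
    and hol: "\<And>t. t \<in> space M \<Longrightarrow> (\<lambda>z. F z t) holomorphic_on S"
    and meas: "\<And>z. z \<in> S \<Longrightarrow> F z \<in> borel_measurable M"
    and dom: "\<And>z0. z0 \<in> S \<Longrightarrow> \<exists>\<rho>>0. \<exists>g. ball z0 \<rho> \<subseteq> S \<and> integrable M g \<and>
                 (\<forall>z\<in>ball z0 \<rho>. \<forall>t\<in>space M. norm (F z t) \<le> g t)"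
  shows "(\<lambda>z. integral\<^sup>L M (F z)) holomorphic_on S"
proof -
  have "\<exists>D. ((\<lambda>z. integral\<^sup>L M (F z)) has_field_derivative D) (at z0)" if "z0 \<in> S" for z0
  proof -
    obtain \<rho> g where \<rho>: "\<rho> > 0" "ball z0 \<rho> \<subseteq> S" and g: "integrable M g"
      and bound: "\<And>z t. z \<in> ball z0 \<rho> \<Longrightarrow> t \<in> space M \<Longrightarrow> norm (F z t) \<le> g t"
      using dom[OF \<open>z0 \<in> S\<close>] by metis
    \<comment> \<open>A third of the radius leaves room for a closed disc of radius
      \<open>\<sigma>\<close> about every point of \<open>ball z0 \<sigma>\<close>; Cauchy's
      inequality is applied on these discs.\<close>
    define \<sigma> where "\<sigma> = \<rho> / 3"
    have \<sigma>: "\<sigma> > 0" "\<And>z. z \<in> ball z0 \<sigma> \<Longrightarrow> cball z \<sigma> \<subseteq> ball z0 \<rho>"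
      using \<rho>(1) by (auto simp: \<sigma>_def dist_norm intro!: subsetI)
        (smt (verit) dist_norm dist_triangle mem_ball dist_commute)+
    have z0B: "ball z0 \<sigma> \<subseteq> ball z0 \<rho>" using \<rho> by (auto simp: \<sigma>_def)
    define G where "G z t = (F z t - F z0 t) / (z - z0)" for z t
    define G0 where "G0 t = deriv (\<lambda>z. F z t) z0" for t
    have lim: "((\<lambda>z. G z t) \<longlongrightarrow> G0 t) (at z0)" if "t \<in> space M" for t
      using holomorphic_derivI[OF hol[OF that] \<open>open S\<close> \<open>z0 \<in> S\<close>]
      unfolding G_def G0_def has_field_derivative_iff by simp
    have Gm: "G z \<in> borel_measurable M" if "z \<in> ball z0 \<sigma>" for z
      using that z0B \<rho>(2) \<open>z0 \<in> S\<close> unfolding G_def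
      by (intro borel_measurable_divide borel_measurable_diff meas) auto
    \<comment> \<open>Measurability of the derivative \<open>G0\<close> follows by writing it as a
      pointwise limit of quotients along one sequence; the \<open>2\<close> keeps even
      \<open>X 0\<close> strictly inside the ball.\<close>
    define X where "X n = z0 + of_real (\<sigma> / (2 + real n))" for n
    have X: "X n \<in> ball z0 \<sigma> - {z0}" for n
      using \<sigma>(1) by (auto simp: X_def dist_norm norm_of_real divide_less_eq add_pos_nonneg algebra_simps
          simp del: of_real_divide of_real_add)
    have Xlim: "X \<longlonglongrightarrow> z0"
    proof -
      have "(\<lambda>n. \<sigma> / (2 + real n)) \<longlonglongrightarrow> 0" 
        by (intro tendsto_divide_0[OF tendsto_const] filterlim_at_top_imp_at_infinity 
            filterlim_tendsto_add_at_top[OF tendsto_const] filterlim_real_sequentially)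
      then have "(\<lambda>n. z0 + of_real (\<sigma> / (2 + real n))) \<longlonglongrightarrow> z0 + of_real 0"
        by (intro tendsto_intros)
      then show ?thesis by (simp add: X_def[abs_def])
    qed
    have G0m: "G0 \<in> borel_measurable M"
    proof (rule borel_measurable_LIMSEQ_metric[where f = "\<lambda>n. G (X n)"])
      show "G (X n) \<in> borel_measurable M" for n using X by (intro Gm) auto
      show "(\<lambda>n. G (X n) t) \<longlonglongrightarrow> G0 t" if "t \<in> space M" for t
        using lim[OF that] X Xlim by (auto simp: tendsto_at_iff_sequentially o_def)
    qed
    have Gb: "norm (G z t) \<le> g t / \<sigma>" if z: "z \<in> ball z0 \<sigma>" "z \<noteq> z0" and t: "t \<in> space M" for z t
    proof -
      have d: "((\<lambda>z. F z t) has_field_derivative deriv (\<lambda>z. F z t) w) (at w within ball z0 \<sigma>)"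
        if "w \<in> ball z0 \<sigma>" for w
        using holomorphic_derivI[OF hol[OF t] \<open>open S\<close>, of w "ball z0 \<sigma>"] that z0B \<rho>(2) by blast
      have "norm (deriv (\<lambda>z. F z t) w) \<le> g t / \<sigma>" if w: "w \<in> ball z0 \<sigma>" for w
      proof -
        have sub: "cball w \<sigma> \<subseteq> S" using \<sigma>(2)[OF w] \<rho>(2) by auto
        have "norm ((deriv ^^ 1) (\<lambda>z. F z t) w) \<le> fact 1 * g t / \<sigma> ^ 1"
        proof (rule Cauchy_inequality)
          show "(\<lambda>z. F z t) holomorphic_on ball w \<sigma>"
            using hol[OF t] sub by (meson ball_subset_cball holomorphic_on_subset subset_trans)
          show "continuous_on (cball w \<sigma>) (\<lambda>z. F z t)"
            using hol[OF t] sub holomorphic_on_imp_continuous_on holomorphic_on_subset by blast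
          show "norm (F x t) \<le> g t" if "norm (w - x) = \<sigma>" for x
            using that \<sigma>(2)[OF w] by (intro bound t) (auto simp: dist_norm subset_iff)
        qed (use \<sigma> in auto)
        then show ?thesis by simp
      qed
      from field_differentiable_bound[OF convex_ball d this z(1), of z0] \<sigma>(1)
      have "norm (F z t - F z0 t) \<le> g t / \<sigma> * norm (z - z0)" by auto
      then show ?thesis using z by (simp add: G_def norm_divide divide_le_eq)
    qed
    have intF: "integrable M (F z)" if "z \<in> ball z0 \<rho>" for z
      using that \<rho>(2) by (intro Bochner_Integration.integrable_bound[OF g meas]) (auto intro!: AE_I2 order_trans[OF bound abs_ge_self])
    have "((\<lambda>z. integral\<^sup>L M (G z)) \<longlongrightarrow> integral\<^sup>L M G0) (at z0 within ball z0 \<sigma>)"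
      using g Gm Gb lim G0m by (intro tendsto_integral_dominated_within[where w = "\<lambda>t. g t / \<sigma>"])
         (auto intro!: AE_I2 tendsto_within_subset[OF lim subset_UNIV])
    moreover have "integral\<^sup>L M (G z) = (integral\<^sup>L M (F z) - integral\<^sup>L M (F z0)) / (z - z0)"
      if "z \<in> ball z0 \<sigma>" for z
    proof -
      have "integrable M (F z)" "integrable M (F z0)"
        using that z0B \<rho>(1) by (auto intro!: intF)
      then show ?thesis by (simp add: G_def[abs_def])
    qed
    ultimately have "((\<lambda>z. (integral\<^sup>L M (F z) - integral\<^sup>L M (F z0)) / (z - z0)) \<longlongrightarrow> integral\<^sup>L M G0) (at z0 within ball z0 \<sigma>)"
      by (subst tendsto_cong) (auto simp: eventually_at_topological intro!: exI[of _ UNIV])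
    then show ?thesis
      using \<sigma>(1) by (auto simp: has_field_derivative_iff at_within_open[of z0 "ball z0 \<sigma>"])
  qed
  then show ?thesis
    using \<open>open S\<close> by (auto simp: holomorphic_on_open)
qed

text \<open>By the claim for \<open>n\<close>, \<open>Q(x)\<^sup>n\<^sup>+\<^sup>1 Q(x)\<close> is a double integral over \<open>s, t \<ge> x\<close>. Its part \<open>t \<le> s\<close>
  gives \<open>n + 1\<close> times the integral for \<open>n + 1\<close>; the part \<open>s < t\<close> gives it once more, by the claim
  for \<open>n\<close> at \<open>s\<close>.\<close>

lemma nn_integral_tail_power:
  fixes w :: "real \<Rightarrow> ennreal"
  assumes [measurable]: "w \<in> borel_measurable borel"
  defines "Q \<equiv> \<lambda>x. \<integral>\<^sup>+t. w t * indicator {x..} t \<partial>lborel"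
  shows "of_nat (Suc n) * (\<integral>\<^sup>+t. w t * Q t ^ n * indicator {x..} t \<partial>lborel) = Q x ^ Suc n"
proof (induction n arbitrary: x)
  case 0
  then show ?case by (simp add: Q_def)
next
  case (Suc n)
  have Qm[measurable]: "Q \<in> borel_measurable borel"
    unfolding Q_def indicator_def atLeast_def mem_Collect_eq by measurable
  let ?N = "of_nat (Suc n) :: ennreal"
  let ?I = "\<lambda>x t. indicator {x..} t :: ennreal"
  let ?J = "\<lambda>x t. indicator {x<..} t :: ennreal"
  have Imeas[measurable]: "(\<lambda>(s, t). indicator {s..} (t::real) :: ennreal) \<in> borel_measurable (borel \<Otimes>\<^sub>M borel)"
    "(\<lambda>(s, t). indicator {s<..} (t::real) :: ennreal) \<in> borel_measurable (borel \<Otimes>\<^sub>M borel)"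
    unfolding indicator_def atLeast_def greaterThan_def mem_Collect_eq by measurable
  \<comment> \<open>The region \<open>s < t\<close> produces an open ray, while the induction
    hypothesis speaks of the closed one; they differ by a null set.\<close>
  have ae: "(\<integral>\<^sup>+t. f t * ?J s t \<partial>lborel) = (\<integral>\<^sup>+t. f t * ?I s t \<partial>lborel)" for f :: "real \<Rightarrow> ennreal" and s
    by (intro nn_integral_cong_AE) (use AE_lborel_singleton[of s] in \<open>eventually_elim, auto simp: indicator_def\<close>)
  define k where "k s t = w s * ?I x s * (w t * Q t ^ n * ?I x t)" for s t
  have km[measurable]: "case_prod k \<in> borel_measurable (borel \<Otimes>\<^sub>M borel)"
    unfolding k_def by measurable
  have "Q x ^ Suc (Suc n) = Q x * (?N * (\<integral>\<^sup>+t. w t * Q t ^ n * ?I x t \<partial>lborel))"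
    by (simp only: Suc.IH power_Suc)
  also have "\<dots> = ?N * (\<integral>\<^sup>+s. w s * ?I x s * (\<integral>\<^sup>+t. w t * Q t ^ n * ?I x t \<partial>lborel) \<partial>lborel)"
    by (subst nn_integral_multc) (auto simp: Q_def mult_ac)
  also have "(\<integral>\<^sup>+s. w s * ?I x s * (\<integral>\<^sup>+t. w t * Q t ^ n * ?I x t \<partial>lborel) \<partial>lborel)
      = (\<integral>\<^sup>+s. (\<integral>\<^sup>+t. k s t \<partial>lborel) \<partial>lborel)"
    unfolding k_def by (intro nn_integral_cong nn_integral_cmult[symmetric]) measurable
  also have "\<dots> = (\<integral>\<^sup>+s. (\<integral>\<^sup>+t. k s t * ?J s t \<partial>lborel) + (\<integral>\<^sup>+t. k s t * ?I t s \<partial>lborel) \<partial>lborel)"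
    by (subst nn_integral_add[symmetric]; (intro nn_integral_cong)?; (measurable)?) (auto simp: indicator_def)
  also have "\<dots> = (\<integral>\<^sup>+s. (\<integral>\<^sup>+t. k s t * ?J s t \<partial>lborel) \<partial>lborel) + (\<integral>\<^sup>+s. (\<integral>\<^sup>+t. k s t * ?I t s \<partial>lborel) \<partial>lborel)"
    by (intro nn_integral_add) measurable
  also have "(\<integral>\<^sup>+s. (\<integral>\<^sup>+t. k s t * ?I t s \<partial>lborel) \<partial>lborel) = (\<integral>\<^sup>+t. (\<integral>\<^sup>+s. k s t * ?I t s \<partial>lborel) \<partial>lborel)"
    by (intro lborel_pair.Fubini') measurable
  \<comment> \<open>For \<open>t \<ge> x\<close> the constraint \<open>s \<ge> t\<close> implies
    \<open>s \<ge> x\<close>, so the inner integral is all of \<open>Q t\<close> and raises the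
    power by one.\<close>
  also have "\<dots> = (\<integral>\<^sup>+t. w t * Q t ^ n * ?I x t * (\<integral>\<^sup>+s. w s * ?I t s \<partial>lborel) \<partial>lborel)"
    by (intro nn_integral_cong, subst nn_integral_cmult[symmetric])
       (auto simp: k_def indicator_def mult_ac intro!: nn_integral_cong)
  also have "\<dots> = (\<integral>\<^sup>+t. w t * Q t ^ Suc n * ?I x t \<partial>lborel)"
    by (intro nn_integral_cong) (simp add: Q_def mult_ac)
  also have "(\<integral>\<^sup>+s. (\<integral>\<^sup>+t. k s t * ?J s t \<partial>lborel) \<partial>lborel)
     = (\<integral>\<^sup>+s. w s * ?I x s * (\<integral>\<^sup>+t. w t * Q t ^ n * ?J s t \<partial>lborel) \<partial>lborel)"
    by (intro nn_integral_cong, subst nn_integral_cmult[symmetric])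
       (auto simp: k_def indicator_def mult_ac intro!: nn_integral_cong)
  finally have "Q x ^ Suc (Suc n) = ?N * (\<integral>\<^sup>+s. w s * ?I x s * (\<integral>\<^sup>+t. w t * Q t ^ n * ?I s t \<partial>lborel) \<partial>lborel)
       + ?N * (\<integral>\<^sup>+t. w t * Q t ^ Suc n * ?I x t \<partial>lborel)"
    by (simp add: ae distrib_left)
  also have "?N * (\<integral>\<^sup>+s. w s * ?I x s * (\<integral>\<^sup>+t. w t * Q t ^ n * ?I s t \<partial>lborel) \<partial>lborel)
      = (\<integral>\<^sup>+s. w s * ?I x s * (?N * (\<integral>\<^sup>+t. w t * Q t ^ n * ?I s t \<partial>lborel)) \<partial>lborel)"
    by (subst nn_integral_cmult[symmetric]) (auto intro!: nn_integral_cong simp: mult_ac)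
  also have "\<dots> = (\<integral>\<^sup>+t. w t * Q t ^ Suc n * ?I x t \<partial>lborel)"
    by (intro nn_integral_cong, subst Suc.IH) (simp add: mult_ac)
  finally show ?case
    by (simp add: distrib_right add.commute)
qed

section \<open>Exponential tail transforms\<close>

text \<open>Dominated convergence delivers limits of difference quotients; this turns them into
  derivatives.\<close>

lemma has_vector_derivative_at_iff_quotient:
  "(f has_vector_derivative D) (at x) \<longleftrightarrow> ((\<lambda>y. (f y - f x) /\<^sub>R (y - x)) \<longlongrightarrow> D) (at x)"
proof -
  have "norm (f y - f x - (y - x) *\<^sub>R D) / norm (y - x) = norm ((f y - f x) /\<^sub>R (y - x) - D)"
    if "y \<noteq> x" for y
  proof -
    have "(f y - f x) /\<^sub>R (y - x) - D = (f y - f x - (y - x) *\<^sub>R D) /\<^sub>R (y - x)"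
      using that by (simp add: scaleR_diff_right)
    then show ?thesis by (simp add: divide_inverse mult.commute)
  qed
  then have "((\<lambda>y. norm (f y - f x - (y - x) *\<^sub>R D) / norm (y - x)) \<longlongrightarrow> 0) (at x)
      \<longleftrightarrow> ((\<lambda>y. norm ((f y - f x) /\<^sub>R (y - x) - D)) \<longlongrightarrow> 0) (at x)"
    by (intro tendsto_cong) (auto simp: eventually_at_topological intro!: exI[of _ UNIV])
  then show ?thesis
    unfolding has_vector_derivative_def has_derivative_iff_norm
    by (simp add: bounded_linear_scaleR_left tendsto_norm_zero_iff LIM_zero_iff)
qed

lemma norm_exp_mult_of_real_le_1:
  fixes \<mu> :: complex
  assumes "Re \<mu> \<le> 0" "s \<ge> 0"
  shows "norm (exp (\<mu> * of_real s)) \<le> 1"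
  using assms by (simp add: mult_nonpos_nonneg)

text \<open>Mean value inequality on the half-line, where the exponential has modulus at most
  \<open>1\<close> and its derivative therefore at most \<open>norm \<mu>\<close>.\<close>

lemma norm_exp_diff_le:
  fixes \<mu> :: complex
  assumes "Re \<mu> \<le> 0" "s \<ge> 0" "s' \<ge> 0"
  shows "norm (exp (\<mu> * of_real s) - exp (\<mu> * of_real s')) \<le> norm \<mu> * \<bar>s - s'\<bar>"
proof -
  have "norm (exp (\<mu> * of_real s) - exp (\<mu> * of_real s')) \<le> norm \<mu> * norm (s - s')"
  proof (rule differentiable_bound[of "{0..}"])
    show "((\<lambda>s. exp (\<mu> * of_real s)) has_derivative (\<lambda>h. h *\<^sub>R (\<mu> * exp (\<mu> * of_real s)))) (at s within {0..})" for s :: real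
      unfolding has_vector_derivative_def[symmetric]
      by (rule has_vector_derivative_real_field) (auto intro!: derivative_eq_intros)
    show "onorm (\<lambda>h. h *\<^sub>R (\<mu> * exp (\<mu> * of_real s))) \<le> norm \<mu>" if "s \<in> {0..}" for s :: real
    proof (rule onorm_le)
      fix h :: real
      have "norm \<mu> * norm (exp (\<mu> * of_real s)) \<le> norm \<mu> * 1"
        using that by (intro mult_left_mono norm_exp_mult_of_real_le_1 assms) auto
      from mult_left_mono[OF this abs_ge_zero[of h]]
      show "norm (h *\<^sub>R (\<mu> * exp (\<mu> * of_real s))) \<le> norm \<mu> * norm h"
        by (simp add: norm_mult mult.commute del: norm_exp_eq_Re)
    qed
  qed (use assms in auto)
  then show ?thesis by simp
qed

text \<open>The contribution of one exponential of the kernel; \<open>\<mu> = 0\<close> gives the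
  plain tail integral of \<open>g\<close>.\<close>

definition tail_exp :: "complex \<Rightarrow> (real \<Rightarrow> complex) \<Rightarrow> real \<Rightarrow> complex" where
  "tail_exp \<mu> g x = (LINT t:{x..}|lebesgue. exp (\<mu> * of_real (t - x)) * g t)"

lemma id_measurable_lebesgue: "(\<lambda>t. t :: real) \<in> borel_measurable lebesgue"
  by (rule measurable_completion) simp

lemma integrable_bounded_mult:
  fixes g h :: "'a \<Rightarrow> 'b::{real_normed_algebra, banach, second_countable_topology}"
  assumes "integrable M g" "h \<in> borel_measurable M" "\<And>t. norm (h t) \<le> B"
  shows "integrable M (\<lambda>t. h t * g t)"
proof (rule Bochner_Integration.integrable_bound)
  show "integrable M (\<lambda>t. B * norm (g t))" using assms by simp
  show "(\<lambda>t. h t * g t) \<in> borel_measurable M"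
    using assms by measurable
  have "norm (h t * g t) \<le> norm (B * norm (g t))" for t
    using mult_right_mono[OF order_trans[OF assms(3)[of t] abs_ge_self], of "norm (g t)"]
    by (auto simp: abs_mult intro: order_trans[OF norm_mult_ineq])
  then show "AE t in M. norm (h t * g t) \<le> norm (B * norm (g t))"
    by simp
qed

lemma set_integrable_tail_exp:
  assumes g: "integrable lebesgue g" and \<mu>: "Re \<mu> \<le> 0"
  shows "set_integrable lebesgue {x..} (\<lambda>t. exp (\<mu> * of_real (t - x)) * g t)"
proof -
  note id_measurable_lebesgue [measurable]
  have [measurable]: "g \<in> borel_measurable lebesgue" using g by simp
  \<comment> \<open>The indicator is grouped with the exponential, which need not be bounded to the
    left of \<open>x\<close>.\<close>
  have "integrable lebesgue (\<lambda>t. (indicator {x..} t * exp (\<mu> * of_real (t - x))) * g t)"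
    using norm_exp_mult_of_real_le_1[OF \<mu>]
    by (intro integrable_bounded_mult[where B = 1] g) 
       (auto simp: indicator_def intro!: borel_measurable_times borel_measurable_indicator)
  also have "(\<lambda>t. (indicator {x..} t * exp (\<mu> * of_real (t - x))) * g t)
      = (\<lambda>t. indicator {x..} t *\<^sub>R (exp (\<mu> * of_real (t - x)) * g t))"
    by (auto simp: indicator_def)
  finally show ?thesis
    by (simp add: set_integrable_def)
qed

text \<open>Subtracting the plain tail makes the exponential factor vanish at \<open>t = x\<close>,
  so the moving endpoint contributes nothing and the derivative exists at every \<open>x\<close>,
  although \<open>g\<close> is merely integrable.\<close>

lemma tail_exp_diff_has_vector_derivative:
  assumes g: "integrable lebesgue g" and \<mu>: "Re \<mu> \<le> 0"
  shows "((\<lambda>x. tail_exp \<mu> g x - tail_exp 0 g x) has_vector_derivative - \<mu> * tail_exp \<mu> g x) (at x)"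
  unfolding has_vector_derivative_at_iff_quotient
proof -
  note id_measurable_lebesgue [measurable]
  have [measurable]: "g \<in> borel_measurable lebesgue" using g by simp
  \<comment> \<open>Clipping at \<open>0\<close> makes the first factor vanish for
    \<open>t < y\<close>. The integral then runs over the whole line and only the integrand depends
    on \<open>y\<close>.\<close>
  define \<phi> where "\<phi> y t = (exp (\<mu> * of_real (max (t - y) 0)) - 1) * g t" for y t
  have \<phi>m[measurable]: "\<phi> y \<in> borel_measurable lebesgue" for y
    unfolding \<phi>_def by measurable
  have \<phi>i: "integrable lebesgue (\<phi> y)" for y
  proof -
    have "norm (exp (\<mu> * of_real (max (t - y) 0)) - 1) \<le> 1 + 1" for t
      using norm_triangle_ineq4[of "exp (\<mu> * of_real (max (t - y) 0))" 1] 
        norm_exp_mult_of_real_le_1[OF \<mu>, of "max (t - y) 0"]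
      by (simp del: norm_exp_eq_Re)
    then show ?thesis
      unfolding \<phi>_def by (intro integrable_bounded_mult[OF g]) auto
  qed
  have eq: "tail_exp \<mu> g y - tail_exp 0 g y = integral\<^sup>L lebesgue (\<phi> y)" for y
  proof -
    have "tail_exp \<mu> g y - tail_exp 0 g y =
        (LINT t:{y..}|lebesgue. exp (\<mu> * of_real (t - y)) * g t - exp (0 * of_real (t - y)) * g t)"
      unfolding tail_exp_def
      by (intro set_integral_diff(2)[symmetric] set_integrable_tail_exp g \<mu>) simp
    then show ?thesis
      by (auto intro!: Bochner_Integration.integral_cong 
          simp: set_lebesgue_integral_def \<phi>_def indicator_def max_def algebra_simps)
  qed
  define \<phi>' where "\<phi>' t = indicator {x..} t *\<^sub>R (- \<mu> * (exp (\<mu> * of_real (t - x)) * g t))" for t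
  have "((\<lambda>y. integral\<^sup>L lebesgue (\<lambda>t. (\<phi> y t - \<phi> x t) /\<^sub>R (y - x))) \<longlongrightarrow> integral\<^sup>L lebesgue \<phi>') (at x)"
  proof (rule tendsto_integral_dominated_within[where w = "\<lambda>t. norm \<mu> * norm (g t)"])
    show "\<phi>' \<in> borel_measurable lebesgue"
      unfolding \<phi>'_def by (intro borel_measurable_scaleR borel_measurable_times borel_measurable_indicator) auto
    show "integrable lebesgue (\<lambda>t. norm \<mu> * norm (g t))"
      using g by simp
    show "AE t in lebesgue. ((\<lambda>y. (\<phi> y t - \<phi> x t) /\<^sub>R (y - x)) \<longlongrightarrow> \<phi>' t) (at x)"
    \<comment> \<open>At \<open>t = x\<close> the clipped integrand can have a corner as a function
      of \<open>y\<close>; this single point is a null set.\<close>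
    proof (rule AE_mp[OF AE_completion[OF AE_lborel_singleton[of x]]], intro AE_I2 impI)
      fix t assume "t \<noteq> x"
      have "((\<lambda>y. \<phi> y t) has_vector_derivative \<phi>' t) (at x)"
      proof (cases "t < x")
        case True
        have "((\<lambda>y. 0) has_vector_derivative \<phi>' t) (at x)"
          using True by (auto simp: \<phi>'_def)
        then show ?thesis
          by (rule has_vector_derivative_transform_within_open[where S = "{t<..}"]) (use True in \<open>auto simp: \<phi>_def\<close>)
      next
        case False
        have "((\<lambda>y. (exp (\<mu> * (of_real t - of_real y)) - 1) * g t) has_vector_derivative \<phi>' t) (at x)"
          by (rule has_vector_derivative_real_field[where f = "\<lambda>z. (exp (\<mu> * (of_real t - z)) - 1) * g t"])
             (use False in \<open>auto intro!: derivative_eq_intros simp: \<phi>'_def\<close>)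
        then show ?thesis
          by (rule has_vector_derivative_transform_within_open[where S = "{..<t}"]) 
             (use False \<open>t \<noteq> x\<close> in \<open>auto simp: \<phi>_def max_def\<close>)
      qed
      then show "((\<lambda>y. (\<phi> y t - \<phi> x t) /\<^sub>R (y - x)) \<longlongrightarrow> \<phi>' t) (at x)"
        by (simp add: has_vector_derivative_at_iff_quotient)
    qed
    fix y assume "y \<noteq> x"
    show "AE t in lebesgue. norm ((\<phi> y t - \<phi> x t) /\<^sub>R (y - x)) \<le> norm \<mu> * norm (g t)"
    proof (intro AE_I2)
      fix t
      have "norm (exp (\<mu> * of_real (max (t - y) 0)) - exp (\<mu> * of_real (max (t - x) 0)))
         \<le> norm \<mu> * \<bar>max (t - y) 0 - max (t - x) 0\<bar>"
        by (rule norm_exp_diff_le[OF \<mu>]) auto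
      \<comment> \<open>Clipping is \<open>1\<close>-Lipschitz, so the bound also covers
        \<open>t\<close> between \<open>x\<close> and \<open>y\<close>.\<close>
      also have "\<dots> \<le> norm \<mu> * \<bar>y - x\<bar>"
        by (intro mult_left_mono) auto
      finally have "norm (\<phi> y t - \<phi> x t) \<le> norm \<mu> * \<bar>y - x\<bar> * norm (g t)"
        using mult_right_mono[OF _ norm_ge_zero[of "g t"]]
        by (auto simp: \<phi>_def norm_mult simp flip: left_diff_distrib)
      then show "norm ((\<phi> y t - \<phi> x t) /\<^sub>R (y - x)) \<le> norm \<mu> * norm (g t)"
        using \<open>y \<noteq> x\<close> by (simp add: divide_simps mult_ac)
    qed
  qed auto
  moreover have "integral\<^sup>L lebesgue \<phi>' = - \<mu> * tail_exp \<mu> g x"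
    unfolding \<phi>'_def tail_exp_def set_lebesgue_integral_def[symmetric] by (rule set_integral_mult_right)
  ultimately show "((\<lambda>y. ((tail_exp \<mu> g y - tail_exp 0 g y) - (tail_exp \<mu> g x - tail_exp 0 g x)) /\<^sub>R (y - x))
       \<longlongrightarrow> - \<mu> * tail_exp \<mu> g x) (at x)"
    by (simp add: eq \<phi>i)
qed

section \<open>The kernel in the sector\<close>

text \<open>Integrability is asked of \<open>B\<close> alone: a non-integrable \<open>f\<close> has
  integral \<open>0\<close>, and \<open>B\<close> is nonnegative on \<open>A\<close>.\<close>

lemma set_integral_norm_le:
  fixes f :: "'a \<Rightarrow> 'b::{banach, second_countable_topology}"
  assumes "set_integrable M A B" "\<And>t. t \<in> A \<Longrightarrow> norm (f t) \<le> B t"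
  shows "norm (LINT t:A|M. f t) \<le> (LINT t:A|M. B t)"
proof -
  have "norm (LINT t:A|M. f t) \<le> (\<integral>t. norm (indicator A t *\<^sub>R f t) \<partial>M)"
    unfolding set_lebesgue_integral_def by (rule integral_norm_bound)
  also have "\<dots> \<le> (LINT t:A|M. B t)"
    using assms unfolding set_lebesgue_integral_def set_integrable_def
    by (intro integral_mono') (auto simp: indicator_def intro: order_trans[OF norm_ge_zero])
  finally show ?thesis .
qed

lemma zeta_0 [simp]: "zeta 0 = 1"
  by (simp add: zeta_def)

lemma zeta_simps:
  "zeta 1 + zeta 2 = -1" "zeta 1 * zeta 2 = 1" "zeta 2 * zeta 1 = 1" "zeta 1 * zeta 1 = zeta 2" "zeta 2 * zeta 2 = zeta 1"
  by (simp_all add: zeta_def complex_eq_iff field_simps flip: of_real_mult)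

lemma norm_zeta: "norm (zeta k) = 1"
  by (simp add: zeta_def cmod_def power2_eq_square field_simps)

definition mu :: "nat \<Rightarrow> complex \<Rightarrow> complex" where
  "mu k l = \<i> * l * (zeta 0 - zeta k)"

lemma mu_0 [simp]: "mu 0 l = 0"
  by (simp add: mu_def)

lemma Re_mu:
  "Re (mu 1 l) = - (sqrt 3 / 2) * (Im l * sqrt 3 - Re l)"
  "Re (mu 2 l) = - (sqrt 3 / 2) * (Im l * sqrt 3 + Re l)"
  by (simp_all add: mu_def zeta_def field_simps)

text \<open>\<open>Omega0\<close> is exactly the set where both exponents have negative real part.
  The decay rate guaranteed for both is a multiple of the quantity whose power \<open>-1/2\<close>
  is \<open>delta\<close>.\<close>

lemma Re_mu_le:
  assumes "k \<in> {1, 2}"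
  shows "Re (mu k l) \<le> - (sqrt 3 / 2) * (Im l * sqrt 3 - \<bar>Re l\<bar>)"
  using assms by (auto simp: Re_mu simp del: One_nat_def intro!: mult_left_mono)

lemma Omega0_D:
  assumes "l \<in> Omega0"
  shows "l \<noteq> 0" "Re (mu 0 l) \<le> 0" "Re (mu 1 l) \<le> 0" "Re (mu 2 l) \<le> 0" "Im l * sqrt 3 - \<bar>Re l\<bar> > 0"
proof -
  show *: "Im l * sqrt 3 - \<bar>Re l\<bar> > 0"
    using assms by (simp add: Omega0_def mult.commute)
  then have "Re (mu k l) \<le> 0" if "k \<in> {1, 2}" for k
    using Re_mu_le[OF that, of l] by (smt (verit) mult_pos_pos half_gt_zero real_sqrt_gt_zero mult_minus_left)
  then show "Re (mu 1 l) \<le> 0" "Re (mu 2 l) \<le> 0" by auto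
  show "l \<noteq> 0" using assms by (auto simp: Omega0_def)
qed simp

lemma open_Omega0: "open Omega0"
  unfolding Omega0_def by (intro open_Collect_less continuous_intros)

text \<open>The estimates carry the factor \<open>1 / (norm l)\<^sup>2\<close>, which blows up at
  the vertex of the sector; local uniformity in \<open>l\<close> needs discs that stay away from
  \<open>0\<close>.\<close>

lemma Omega0_ball:
  assumes "z0 \<in> Omega0"
  obtains \<rho> where "\<rho> > 0" "cball z0 \<rho> \<subseteq> Omega0" "\<And>z. z \<in> cball z0 \<rho> \<Longrightarrow> norm z \<ge> norm z0 / 2"
proof -
  obtain \<rho> where \<rho>: "\<rho> > 0" "cball z0 \<rho> \<subseteq> Omega0"
    using open_Omega0 assms open_contains_cball by blast
  have z0: "norm z0 > 0" using Omega0_D assms by simp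
  show ?thesis
  proof (rule that)
    show "min \<rho> (norm z0 / 2) > 0" "cball z0 (min \<rho> (norm z0 / 2)) \<subseteq> Omega0" using \<rho> z0 by auto
    show "norm z \<ge> norm z0 / 2" if "z \<in> cball z0 (min \<rho> (norm z0 / 2))" for z
      using that norm_triangle_ineq2[of z0 z] by (auto simp: dist_norm)
  qed
qed

text \<open>One family for all kernels in use: coefficients \<open>1, zeta 1, zeta 2\<close> belong
  to \<open>psi0\<close>, \<open>1, zeta 2, zeta 1\<close> to the first derivative and
  \<open>1, 1, 1\<close> to the second; \<open>c = 0\<close> leaves the decaying part.\<close>

definition kern :: "complex \<Rightarrow> complex \<Rightarrow> complex \<Rightarrow> complex \<Rightarrow> real \<Rightarrow> complex" where
  "kern c a b l s = c + a * exp (mu 1 l * of_real s) + b * exp (mu 2 l * of_real s)"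

lemma norm_kern_le:
  assumes "l \<in> Omega0" "s \<ge> 0"
  shows "norm (kern c a b l s) \<le> norm c + norm a + norm b"
proof -
  have "norm (kern c a b l s) \<le> norm c + norm a * norm (exp (mu 1 l * of_real s)) + norm b * norm (exp (mu 2 l * of_real s))"
    unfolding kern_def by (auto simp: norm_mult simp del: norm_exp_eq_Re intro!: norm_triangle_le add_mono)
  also have "\<dots> \<le> norm c + norm a * 1 + norm b * 1"
    using assms Omega0_D[OF assms(1)] by (intro add_mono mult_left_mono norm_exp_mult_of_real_le_1) auto
  finally show ?thesis by simp
qed

text \<open>The outer exponential turns the exponents of \<open>s2\<close> into
  \<open>mu k l\<close>; the prefactor collects the third in \<open>s2\<close> and
  \<open>(\<i> * l)\<^sup>2 = - l\<^sup>2\<close>.\<close>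

lemma psi_integrand_eq:
  assumes "l \<noteq> 0"
  shows "psi_integrand q l f x t = - 1 / (3 * l\<^sup>2) * (kern 1 (zeta 1) (zeta 2) l (t - x) * (of_real (q t) * f t))"
proof -
  have z: "zeta 1 powi (-2) = zeta 1" "zeta 2 powi (-2) = zeta 2"
  proof -
    have "zeta k powi (-2) = inverse (zeta k * zeta k)" for k
      by (simp add: power_int_minus power2_eq_square)
    then show "zeta 1 powi (-2) = zeta 1" "zeta 2 powi (-2) = zeta 2"
      using zeta_simps inverse_unique by metis+
  qed
  have e: "exp (\<i> * l * zeta 0 * of_real (t - x)) * exp (zeta k * (\<i> * l * of_real (x - t))) = exp (mu k l * of_real (t - x))" for k
    by (simp add: exp_add[symmetric] mu_def algebra_simps)
  have "exp (\<i> * l * zeta 0 * of_real (t - x)) * s2 (\<i> * l * of_real (x - t)) = kern 1 (zeta 1) (zeta 2) l (t - x) / 3"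
  proof -
    have "{0..2::nat} = {0, 1, 2}" by auto
    then have "s2 w = (exp w + zeta 1 * exp (zeta 1 * w) + zeta 2 * exp (zeta 2 * w)) / 3" for w
      using z by (simp add: s2_def)
    then have s: "E * s2 w = (E * exp (zeta 0 * w) + zeta 1 * (E * exp (zeta 1 * w)) + zeta 2 * (E * exp (zeta 2 * w))) / 3" for E w
      by (simp add: algebra_simps)
    show ?thesis
      unfolding s e kern_def by simp
  qed
  then have "psi_integrand q l f x t = kern 1 (zeta 1) (zeta 2) l (t - x) / 3 / (\<i> * l)\<^sup>2 * (of_real (q t) * f t)"
    unfolding psi_integrand_def times_divide_eq_right by (simp only: mult.assoc)
  then show ?thesis
    by (simp add: power_mult_distrib)
qed

lemma set_integrable_kern:
  assumes "l \<in> Omega0" "integrable lebesgue g"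
  shows "set_integrable lebesgue {x..} (\<lambda>t. kern c a b l (t - x) * g t)"
    and "(LINT t:{x..}|lebesgue. kern c a b l (t - x) * g t)
          = c * tail_exp 0 g x + a * tail_exp (mu 1 l) g x + b * tail_exp (mu 2 l) g x"
proof -
  note i = set_integrable_tail_exp[OF assms(2) Omega0_D(2)[OF assms(1)], of x]
    set_integrable_tail_exp[OF assms(2) Omega0_D(3)[OF assms(1)], of x]
    set_integrable_tail_exp[OF assms(2) Omega0_D(4)[OF assms(1)], of x]
  have e: "(\<lambda>t. kern c a b l (t - x) * g t) = (\<lambda>t. (c * (exp (mu 0 l * of_real (t - x)) * g t) 
     + a * (exp (mu 1 l * of_real (t - x)) * g t)) + b * (exp (mu 2 l * of_real (t - x)) * g t))"
    by (simp add: kern_def algebra_simps)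
  show "set_integrable lebesgue {x..} (\<lambda>t. kern c a b l (t - x) * g t)"
    unfolding e by (intro set_integral_add set_integrable_mult_right i)
  show "(LINT t:{x..}|lebesgue. kern c a b l (t - x) * g t)
          = c * tail_exp 0 g x + a * tail_exp (mu 1 l) g x + b * tail_exp (mu 2 l) g x"
    unfolding e by (subst set_integral_add, (intro set_integral_add set_integrable_mult_right i)+,
       subst set_integral_add, (intro set_integral_add set_integrable_mult_right i)+)
      (simp only: set_integral_mult_right tail_exp_def mu_0)
qed

text \<open>The derivative of a single \<^term>\<open>tail_exp\<close> contains the merely integrable term \<open>- g x\<close>,
  which cancels exactly when the coefficients sum to \<open>0\<close>.\<close>

lemma tail_exp_combination_has_vector_derivative:
  assumes "l \<in> Omega0" "integrable lebesgue g" "c + a + b = 0"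
  shows "((\<lambda>x. c * tail_exp 0 g x + a * tail_exp (mu 1 l) g x + b * tail_exp (mu 2 l) g x) has_vector_derivative
           - (a * mu 1 l * tail_exp (mu 1 l) g x + b * mu 2 l * tail_exp (mu 2 l) g x)) (at x)"
proof -
  have c: "c = - a - b" using assms(3) by algebra
  have "((\<lambda>x. a * (tail_exp (mu 1 l) g x - tail_exp 0 g x) + b * (tail_exp (mu 2 l) g x - tail_exp 0 g x)) has_vector_derivative
        a * (- mu 1 l * tail_exp (mu 1 l) g x) + b * (- mu 2 l * tail_exp (mu 2 l) g x)) (at x)"
    using Omega0_D[OF assms(1)] assms(2)
    by (intro has_vector_derivative_add has_vector_derivative_mult_right tail_exp_diff_has_vector_derivative)
  then show ?thesis by (simp add: c algebra_simps)
qed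

section \<open>Successive approximations\<close>

text \<open>A class that contains the starting function and \<open>psi0\<close> and is preserved by
  \<open>psi_map\<close>: continuity supplies measurability, and boundedness makes the product with
  \<open>q\<close> integrable.\<close>

definition admissible :: "(real \<Rightarrow> complex) \<Rightarrow> bool" where
  "admissible f \<longleftrightarrow> continuous_on UNIV f \<and> bounded (range f)"

lemma admissible_const [simp]: "admissible (\<lambda>_. c)"
  by (simp add: admissible_def)

lemma summable_exp_divide: "summable (\<lambda>n. (y::real) ^ n / fact n)" "(\<Sum>n. y ^ n / fact n) = exp y"
  using exp_converges[of y] by (simp_all add: sums_iff scaleR_conv_of_real divide_inverse mult.commute)

locale integrable_potential =
  fixes q :: "real \<Rightarrow> real"
  assumes integrable_q: "integrable lebesgue q"
begin

lemma q_measurable [measurable]: "q \<in> borel_measurable lebesgue"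
  using integrable_q by simp

section \<open>Tail integrals of the potential and the integral operator\<close>

definition Q :: "real \<Rightarrow> real" where
  "Q x = (LINT t:{x..}|lebesgue. \<bar>q t\<bar>)"

lemma set_integrable_abs_q: "set_integrable lebesgue {x..} (\<lambda>t. \<bar>q t\<bar>)"
  unfolding set_integrable_def using integrable_q by (intro integrable_mult_indicator) auto

lemma Q_nonneg: "Q x \<ge> 0"
  unfolding Q_def set_lebesgue_integral_def by (intro Bochner_Integration.integral_nonneg) auto

definition q1 :: real where "q1 = (LINT t|lebesgue. \<bar>q t\<bar>)"

lemma Q_le_q1: "Q x \<le> q1"
  unfolding Q_def set_lebesgue_integral_def q1_def using integrable_q
  by (intro integral_mono') (auto simp: indicator_def)

text \<open>Formally \<open>Q' = - \<bar>q\<bar>\<close>, so the integrand is the derivative of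
  \<open>- Q ^ Suc n / Suc n\<close>. As \<open>q\<close> is only integrable, the identity is taken
  from \<open>nn_integral_tail_power\<close>; the divisor \<open>Suc n\<close> later builds up the
  factorial.\<close>

lemma set_integral_q_power:
  "set_integrable lebesgue {x..} (\<lambda>t. \<bar>q t\<bar> * Q t ^ n)"
  "(LINT t:{x..}|lebesgue. \<bar>q t\<bar> * Q t ^ n) = Q x ^ Suc n / Suc n"
proof -
  \<comment> \<open>\<open>nn_integral_tail_power\<close> asks for a Borel function, whereas
    \<open>q\<close> is Lebesgue measurable; the Borel representative \<open>p\<close> changes none
    of the integrals.\<close>
  obtain p where p[measurable]: "p \<in> borel_measurable lborel" and qp: "AE t in lborel. q t = p t"
    using completion_ex_borel_measurable_real[OF q_measurable] by auto
  define w where "w t = ennreal \<bar>p t\<bar>" for t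
  have [measurable]: "w \<in> borel_measurable borel" using p unfolding w_def by measurable
  define R where "R x = (\<integral>\<^sup>+t. w t * indicator {x..} t \<partial>lborel)" for x
  have R: "R x = ennreal (Q x)" for x
  proof -
    have "R x = (\<integral>\<^sup>+t. ennreal (indicator {x..} t *\<^sub>R \<bar>q t\<bar>) \<partial>lebesgue)"
      unfolding R_def nn_integral_completion w_def
      by (intro nn_integral_cong_AE) (use qp in \<open>eventually_elim, auto simp: indicator_def\<close>)
    also have "\<dots> = ennreal (Q x)"
      unfolding Q_def set_lebesgue_integral_def
      by (intro nn_integral_eq_integral set_integrable_abs_q[unfolded set_integrable_def]) auto
    finally show ?thesis .
  qed
  have "Q = (\<lambda>x. enn2real (R x))" using Q_nonneg by (auto simp: R)
  moreover have Rm[measurable]: "R \<in> borel_measurable borel"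
    unfolding R_def indicator_def atLeast_def mem_Collect_eq by measurable
  ultimately have "Q \<in> borel_measurable borel" by simp
  then have [measurable]: "Q \<in> borel_measurable lebesgue"
    by (intro measurable_completion) simp
  have "has_bochner_integral lebesgue (\<lambda>t. Suc n * (indicator {x..} t *\<^sub>R (\<bar>q t\<bar> * Q t ^ n))) (Q x ^ Suc n)"
  proof (rule has_bochner_integral_nn_integral)
    have "(\<integral>\<^sup>+t. ennreal (Suc n * (indicator {x..} t *\<^sub>R (\<bar>q t\<bar> * Q t ^ n))) \<partial>lebesgue)
        = (\<integral>\<^sup>+t. of_nat (Suc n) * (w t * R t ^ n * indicator {x..} t) \<partial>lborel)"
      unfolding nn_integral_completion
      by (intro nn_integral_cong_AE) 
         (use qp in \<open>eventually_elim, auto simp: indicator_def R w_def Q_nonneg ennreal_mult ennreal_power ennreal_of_nat_eq_real_of_nat simp del: of_nat_Suc\<close>)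
    also have "\<dots> = of_nat (Suc n) * (\<integral>\<^sup>+t. w t * R t ^ n * indicator {x..} t \<partial>lborel)"
      by (intro nn_integral_cmult) measurable
    also have "\<dots> = R x ^ Suc n"
      unfolding R_def by (rule nn_integral_tail_power) measurable
    finally show "(\<integral>\<^sup>+t. ennreal (Suc n * (indicator {x..} t *\<^sub>R (\<bar>q t\<bar> * Q t ^ n))) \<partial>lebesgue) = ennreal (Q x ^ Suc n)"
      by (simp only: R ennreal_power Q_nonneg)
    show "(\<lambda>t. Suc n * (indicator {x..} t *\<^sub>R (\<bar>q t\<bar> * Q t ^ n))) \<in> borel_measurable lebesgue"
      by (intro borel_measurable_times borel_measurable_scaleR borel_measurable_indicator) auto
  qed (auto simp: Q_nonneg simp del: of_nat_Suc)
  then have "has_bochner_integral lebesgue (\<lambda>t. indicator {x..} t *\<^sub>R (\<bar>q t\<bar> * Q t ^ n)) (Q x ^ Suc n / Suc n)"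
    using has_bochner_integral_mult_right[of "1 / Suc n" lebesgue] by (force simp del: of_nat_Suc)
  then show "set_integrable lebesgue {x..} (\<lambda>t. \<bar>q t\<bar> * Q t ^ n)"
    "(LINT t:{x..}|lebesgue. \<bar>q t\<bar> * Q t ^ n) = Q x ^ Suc n / Suc n"
    by (auto simp: set_integrable_def set_lebesgue_integral_def has_bochner_integral_iff)
qed

lemma integrable_q_mult:
  assumes "admissible f"
  shows "integrable lebesgue (\<lambda>t. of_real (q t) * f t)"
proof -
  obtain B where B: "\<And>t. norm (f t) \<le> B"
    using assms by (auto simp: admissible_def bounded_iff)
  have "f \<in> borel_measurable lebesgue"
    using assms by (intro measurable_completion) (simp add: admissible_def borel_measurable_continuous_onI)
  then have "integrable lebesgue (\<lambda>t. f t * of_real (q t))"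
    using integrable_q by (intro integrable_bounded_mult[where B = B] B) auto
  then show ?thesis by (simp add: mult.commute)
qed

lemma psi_map_eq:
  assumes "l \<in> Omega0" "admissible f"
  defines "g \<equiv> \<lambda>t. of_real (q t) * f t"
  shows "set_integrable lebesgue {x..} (psi_integrand q l f x)"
    and "psi_map q l f x = 1 + \<i> / (3 * l\<^sup>2) * (LINT t:{x..}|lebesgue. kern 1 (zeta 1) (zeta 2) l (t - x) * g t)"
    and "psi_map q l f x = 1 + \<i> / (3 * l\<^sup>2) * (1 * tail_exp 0 g x + zeta 1 * tail_exp (mu 1 l) g x + zeta 2 * tail_exp (mu 2 l) g x)"
proof -
  have l: "l \<noteq> 0" using Omega0_D assms(1) by blast
  have g: "integrable lebesgue g" unfolding g_def by (rule integrable_q_mult[OF assms(2)])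
  have e: "psi_integrand q l f x = (\<lambda>t. - 1 / (3 * l\<^sup>2) * (kern 1 (zeta 1) (zeta 2) l (t - x) * g t))"
    by (auto simp: psi_integrand_eq[OF l] g_def)
  show "set_integrable lebesgue {x..} (psi_integrand q l f x)"
    unfolding e by (intro set_integrable_mult_right set_integrable_kern assms g)
  show *: "psi_map q l f x = 1 + \<i> / (3 * l\<^sup>2) * (LINT t:{x..}|lebesgue. kern 1 (zeta 1) (zeta 2) l (t - x) * g t)"
    unfolding psi_map_def e set_integral_mult_right by simp
  show "psi_map q l f x = 1 + \<i> / (3 * l\<^sup>2) * (1 * tail_exp 0 g x + zeta 1 * tail_exp (mu 1 l) g x + zeta 2 * tail_exp (mu 2 l) g x)"
    unfolding * set_integrable_kern(2)[OF assms(1) g] ..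
qed

text \<open>The coefficients \<open>1, zeta 1, zeta 2\<close> sum to \<open>0\<close>, so the image
  is even differentiable.\<close>

lemma continuous_on_psi_map:
  assumes "l \<in> Omega0" "admissible f"
  shows "continuous_on UNIV (psi_map q l f)"
proof -
  have "((\<lambda>x. 1 * tail_exp 0 (\<lambda>t. of_real (q t) * f t) x + zeta 1 * tail_exp (mu 1 l) (\<lambda>t. of_real (q t) * f t) x 
      + zeta 2 * tail_exp (mu 2 l) (\<lambda>t. of_real (q t) * f t) x) has_vector_derivative
      - (zeta 1 * mu 1 l * tail_exp (mu 1 l) (\<lambda>t. of_real (q t) * f t) x + zeta 2 * mu 2 l * tail_exp (mu 2 l) (\<lambda>t. of_real (q t) * f t) x)) (at x)" for x
    using zeta_simps(1) by (intro tail_exp_combination_has_vector_derivative assms(1) integrable_q_mult assms(2)) (simp add: add.assoc)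
  then have "continuous_on UNIV (\<lambda>x. 1 * tail_exp 0 (\<lambda>t. of_real (q t) * f t) x + zeta 1 * tail_exp (mu 1 l) (\<lambda>t. of_real (q t) * f t) x 
      + zeta 2 * tail_exp (mu 2 l) (\<lambda>t. of_real (q t) * f t) x)"
    using has_vector_derivative_continuous continuous_at_imp_continuous_on by blast
  then show ?thesis
    unfolding psi_map_eq(3)[OF assms, abs_def]
    by (rule continuous_on_add[OF continuous_on_const continuous_on_mult_left])
qed

text \<open>The \<open>3\<close> bounds \<open>1 + norm a + norm b\<close>; it later cancels against
  the \<open>1 / 3\<close> in the prefactors.\<close>

lemma norm_kern_integral_le:
  assumes "l \<in> Omega0" "set_integrable lebesgue {x..} (\<lambda>t. \<bar>q t\<bar> * B t)" "\<And>t. t \<ge> x \<Longrightarrow> norm (h t) \<le> B t"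
    and "norm a \<le> 1" "norm b \<le> 1"
  shows "norm (LINT t:{x..}|lebesgue. kern 1 a b l (t - x) * (of_real (q t) * h t)) \<le> 3 * (LINT t:{x..}|lebesgue. \<bar>q t\<bar> * B t)"
proof -
  have "norm (LINT t:{x..}|lebesgue. kern 1 a b l (t - x) * (of_real (q t) * h t)) \<le> (LINT t:{x..}|lebesgue. 3 * (\<bar>q t\<bar> * B t))"
  proof (rule set_integral_norm_le)
    show "set_integrable lebesgue {x..} (\<lambda>t. 3 * (\<bar>q t\<bar> * B t))" using assms(2) by simp
    fix t assume t: "t \<in> {x..}"
    have "norm (kern 1 a b l (t - x)) \<le> norm (1::complex) + norm a + norm b"
      using t by (intro norm_kern_le assms) auto
    then have "norm (kern 1 a b l (t - x)) \<le> 3" using assms(4,5) by simp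
    then show "norm (kern 1 a b l (t - x) * (of_real (q t) * h t)) \<le> 3 * (\<bar>q t\<bar> * B t)"
      unfolding norm_mult norm_of_real using t by (intro mult_mono assms(3)) auto
  qed
  then show ?thesis by simp
qed

text \<open>The majorant \<open>B\<close> remains a function of \<open>t\<close>, so that iteration
  gains a factorial; constant majorants would give only a geometric series.\<close>

lemma norm_psi_map_diff_le:
  assumes "l \<in> Omega0" "admissible f" "admissible f'"
    and "set_integrable lebesgue {x..} (\<lambda>t. \<bar>q t\<bar> * B t)" "\<And>t. t \<ge> x \<Longrightarrow> norm (f t - f' t) \<le> B t"
  shows "norm (psi_map q l f x - psi_map q l f' x) \<le> (LINT t:{x..}|lebesgue. \<bar>q t\<bar> * B t) / (norm l)\<^sup>2"
proof -
  have "psi_map q l f x - psi_map q l f' x = \<i> / (3 * l\<^sup>2) * (LINT t:{x..}|lebesgue. kern 1 (zeta 1) (zeta 2) l (t - x) * (of_real (q t) * (f t - f' t)))"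
    unfolding psi_map_eq(2)[OF assms(1,2)] psi_map_eq(2)[OF assms(1,3)]
    by (simp add: right_diff_distrib set_integral_diff(2) set_integrable_kern assms integrable_q_mult del: One_nat_def)
  also have "norm \<dots> \<le> 1 / (3 * (norm l)\<^sup>2) * (3 * (LINT t:{x..}|lebesgue. \<bar>q t\<bar> * B t))"
    unfolding norm_mult[of "\<i> / _"] using assms norm_zeta
    by (intro mult_mono norm_kern_integral_le) (auto simp: norm_divide norm_mult norm_power)
  finally show ?thesis by simp
qed


lemma q1_nonneg: "q1 \<ge> 0"
  using Q_nonneg Q_le_q1 order_trans by blast

lemma set_integrable_abs_q_const: "set_integrable lebesgue {x..} (\<lambda>t. \<bar>q t\<bar> * B)"
  using set_integrable_abs_q by simp

lemma psi_map_0: "psi_map q l (\<lambda>_. 0) x = 1"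
  by (simp add: psi_map_def psi_integrand_def)

lemma admissible_psi_map:
  assumes "l \<in> Omega0" "admissible f"
  shows "admissible (psi_map q l f)"
proof -
  obtain B where B: "\<And>t. norm (f t) \<le> B"
    using assms by (auto simp: admissible_def bounded_iff)
  have "B \<ge> 0" using order_trans[OF norm_ge_zero B] .
  have "norm (psi_map q l f x) \<le> 1 + q1 * B / (norm l)\<^sup>2" for x
  proof -
    \<comment> \<open>The zero function is mapped to \<open>1\<close>, so a difference estimate
      bounds \<open>psi_map q l f\<close> itself.\<close>
    have "norm (psi_map q l f x - psi_map q l (\<lambda>_. 0) x) \<le> (LINT t:{x..}|lebesgue. \<bar>q t\<bar> * B) / (norm l)\<^sup>2"
      using B by (intro norm_psi_map_diff_le assms set_integrable_abs_q_const) auto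
    also have "\<dots> = Q x * B / (norm l)\<^sup>2" by (simp add: Q_def)
    also have "\<dots> \<le> q1 * B / (norm l)\<^sup>2"
      using \<open>B \<ge> 0\<close> Q_le_q1 by (intro divide_right_mono mult_right_mono) auto
    finally show ?thesis
      using norm_triangle_ineq2[of "psi_map q l f x" 1] by (simp add: psi_map_0)
  qed
  then have "bounded (range (psi_map q l f))" by (auto simp: bounded_iff)
  then show ?thesis using continuous_on_psi_map[OF assms] by (simp add: admissible_def)
qed

section \<open>Convergence of the Neumann series\<close>

lemma admissible_psi_approx: "l \<in> Omega0 \<Longrightarrow> admissible (psi_approx q l n)"
  by (induction n) (auto intro: admissible_psi_map)

text \<open>The terms of the Neumann series. The predecessor of the zeroth approximation is taken as
  \<open>0\<close>, so term \<open>0\<close> is \<open>1\<close> and the partial sums telescope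
  exactly.\<close>

definition psi_step :: "complex \<Rightarrow> nat \<Rightarrow> real \<Rightarrow> complex" where
  "psi_step l n x = psi_approx q l n x - (case n of 0 \<Rightarrow> 0 | Suc m \<Rightarrow> psi_approx q l m x)"

lemma psi_approx_eq_sum: "psi_approx q l n x = (\<Sum>k<Suc n. psi_step l k x)"
  by (induction n) (simp_all add: psi_step_def)

text \<open>Feeding the bound for \<open>n\<close> into the difference estimate integrates
  \<open>\<bar>q t\<bar> * Q t ^ n\<close> to \<open>Q x ^ Suc n / Suc n\<close> and adds a factor
  \<open>1 / (norm l)\<^sup>2\<close>.\<close>

lemma norm_psi_step_le:
  assumes "l \<in> Omega0"
  shows "norm (psi_step l n x) \<le> (Q x / (norm l)\<^sup>2) ^ n / fact n"
proof (induction n arbitrary: x)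
  case 0
  then show ?case by (simp add: psi_step_def)
next
  case (Suc n)
  \<comment> \<open>Since \<open>psi_map\<close> sends \<open>0\<close> to \<open>1\<close>, the
    choice \<open>0\<close> for \<open>n = 0\<close> presents the first step, too, as a difference
    of two images of \<open>psi_map\<close>.\<close>
  define f where "f = (case n of 0 \<Rightarrow> (\<lambda>_. 0) | Suc m \<Rightarrow> psi_approx q l m)"
  have f: "admissible f" "psi_step l n t = psi_approx q l n t - f t" 
    "psi_step l (Suc n) x = psi_map q l (psi_approx q l n) x - psi_map q l f x" for t
    by (auto simp: f_def psi_step_def psi_map_0 admissible_psi_approx assms split: nat.splits)
  let ?c = "1 / ((norm l)\<^sup>2 ^ n * fact n)"
  have e: "\<bar>q t\<bar> * ((Q t / (norm l)\<^sup>2) ^ n / fact n) = ?c * (\<bar>q t\<bar> * Q t ^ n)" for t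
    by (simp add: power_divide)
  have "norm (psi_step l (Suc n) x) \<le> (LINT t:{x..}|lebesgue. \<bar>q t\<bar> * ((Q t / (norm l)\<^sup>2) ^ n / fact n)) / (norm l)\<^sup>2"
    unfolding f(3) using Suc.IH f
    by (intro norm_psi_map_diff_le assms admissible_psi_approx)
       (auto simp only: e intro!: set_integrable_mult_right set_integral_q_power)
  also have "\<dots> = (Q x / (norm l)\<^sup>2) ^ Suc n / fact (Suc n)"
    unfolding e set_integral_mult_right set_integral_q_power
    by (simp add: power_divide)
  finally show ?case .
qed

text \<open>A summable majorant free of \<open>x\<close> and \<open>l\<close>, as the Weierstrass
  M-test requires.\<close>

lemma norm_psi_step_le_uniform:
  assumes "l \<in> Omega0" "m > 0" "norm l \<ge> m"
  shows "norm (psi_step l n x) \<le> (q1 / m\<^sup>2) ^ n / fact n"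
proof -
  have "Q x / (norm l)\<^sup>2 \<le> q1 / m\<^sup>2"
    using Q_le_q1 q1_nonneg assms by (intro frac_le power_mono) auto
  then have "(Q x / (norm l)\<^sup>2) ^ n / fact n \<le> (q1 / m\<^sup>2) ^ n / fact n"
    by (intro divide_right_mono power_mono) (auto simp: Q_nonneg)
  then show ?thesis using norm_psi_step_le[OF assms(1), of n x] by linarith
qed

lemma norm_psi_approx_le:
  assumes "l \<in> Omega0" "m > 0" "norm l \<ge> m"
  shows "norm (psi_approx q l n x) \<le> exp (q1 / m\<^sup>2)"
proof -
  have "norm (psi_approx q l n x) \<le> (\<Sum>k<Suc n. (q1 / m\<^sup>2) ^ k / fact k)"
    unfolding psi_approx_eq_sum by (intro sum_norm_le norm_psi_step_le_uniform assms)
  also have "\<dots> \<le> exp (q1 / m\<^sup>2)"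
    unfolding summable_exp_divide(2)[symmetric] using q1_nonneg
    by (intro sum_le_suminf summable_exp_divide) auto
  finally show ?thesis .
qed

lemma psi_approx_LIMSEQ:
  assumes "l \<in> Omega0"
  shows "(\<lambda>n. psi_approx q l n x) \<longlonglongrightarrow> psi0 q l x" "psi0 q l x = (\<Sum>k. psi_step l k x)"
    "summable (\<lambda>k. psi_step l k x)"
proof -
  show s: "summable (\<lambda>k. psi_step l k x)"
    by (rule summable_comparison_test'[OF summable_exp_divide(1)]) (rule norm_psi_step_le[OF assms])
  have "(\<lambda>n. psi_approx q l n x) \<longlonglongrightarrow> (\<Sum>k. psi_step l k x)"
    unfolding psi_approx_eq_sum using summable_LIMSEQ[OF s] by (rule LIMSEQ_Suc)
  then show "(\<lambda>n. psi_approx q l n x) \<longlonglongrightarrow> psi0 q l x" "psi0 q l x = (\<Sum>k. psi_step l k x)"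
    by (simp_all add: psi0_def limI)
qed

text \<open>Both \<open>l\<close> and \<open>x\<close> are functions of \<open>y\<close>, so one
  statement serves continuity (\<open>l\<close> fixed) and analyticity (\<open>x\<close>
  fixed).\<close>

lemma uniform_limit_psi_approx:
  assumes "m > 0" "\<And>y. y \<in> A \<Longrightarrow> l y \<in> Omega0 \<and> norm (l y) \<ge> m"
  shows "uniform_limit A (\<lambda>n y. psi_approx q (l y) n (x y)) (\<lambda>y. psi0 q (l y) (x y)) sequentially"
proof -
  have "uniform_limit A (\<lambda>n y. \<Sum>k<n. psi_step (l y) k (x y)) (\<lambda>y. \<Sum>k. psi_step (l y) k (x y)) sequentially"
    using assms by (intro Weierstrass_m_test[OF _ summable_exp_divide(1)[of "q1 / m\<^sup>2"]] norm_psi_step_le_uniform) auto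
  \<comment> \<open>The approximation with index \<open>n\<close> is the partial sum with
    \<open>n + 1\<close> terms.\<close>
  from filterlim_compose[OF this filterlim_Suc]
  have "uniform_limit A (\<lambda>n y. psi_approx q (l y) n (x y)) (\<lambda>y. \<Sum>k. psi_step (l y) k (x y)) sequentially"
    by (simp only: psi_approx_eq_sum)
  then show ?thesis
    using assms by (subst (asm) uniform_limit_cong'[OF _ psi_approx_LIMSEQ(2)[symmetric]]) auto
qed

text \<open>Term \<open>0\<close> of the series is \<open>1\<close>; the others are dominated by the
  exponential series without its first term.\<close>

lemma norm_psi0_minus_1_le:
  assumes "l \<in> Omega0"
  shows "norm (psi0 q l x - 1) \<le> exp (Q x / (norm l)\<^sup>2) - 1"
proof -
  let ?M = "\<lambda>n. (Q x / (norm l)\<^sup>2) ^ n / fact n"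
  have "psi0 q l x - 1 = (\<Sum>k. psi_step l (Suc k) x)"
    using suminf_split_head[OF psi_approx_LIMSEQ(3)[OF assms]] psi_approx_LIMSEQ(2)[OF assms]
    by (simp add: psi_step_def)
  also have "norm \<dots> \<le> (\<Sum>k. ?M (Suc k))"
    using summable_Suc_iff[of ?M] summable_exp_divide(1)
    by (intro norm_suminf_le[OF norm_psi_step_le[OF assms]]) blast
  also have "\<dots> = exp (Q x / (norm l)\<^sup>2) - 1"
    using suminf_split_head[OF summable_exp_divide(1)[of "Q x / (norm l)\<^sup>2"]] summable_exp_divide(2) by simp
  finally show ?thesis .
qed

lemma admissible_psi0:
  assumes "l \<in> Omega0"
  shows "admissible (psi0 q l)"
proof -
  have l: "norm l > 0" using Omega0_D assms by simp
  have "uniform_limit UNIV (\<lambda>n y. psi_approx q l n y) (\<lambda>y. psi0 q l y) sequentially"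
    using uniform_limit_psi_approx[OF l, of UNIV "\<lambda>_. l" "\<lambda>x. x"] assms by auto
  then have "continuous_on UNIV (psi0 q l)"
    using admissible_psi_approx[OF assms]
    by (intro uniform_limit_theorem[of _ "\<lambda>n. psi_approx q l n"]) (auto simp: admissible_def)
  moreover have "norm (psi0 q l x) \<le> exp (q1 / (norm l)\<^sup>2)" for x
    using norm_psi_approx_le[OF assms l] by (intro LIMSEQ_le_const2[OF tendsto_norm[OF psi_approx_LIMSEQ(1)[OF assms]]]) auto
  then have "bounded (range (psi0 q l))" by (auto simp: bounded_iff)
  ultimately show ?thesis by (simp add: admissible_def)
qed

section \<open>Passage to the limit: the integral equation and analyticity in the parameter\<close>

lemma norm_psi_integrand_le:
  assumes "l \<in> Omega0" "t \<ge> x" "m > 0" "norm l \<ge> m" "norm (f t) \<le> B"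
  shows "norm (psi_integrand q l f x t) \<le> B / m\<^sup>2 * \<bar>q t\<bar>"
proof -
  have l: "l \<noteq> 0" using Omega0_D assms by blast
  have B: "B \<ge> 0" using assms(5) norm_ge_zero order_trans by blast
  have "norm (kern 1 (zeta 1) (zeta 2) l (t - x)) \<le> 3"
    using norm_kern_le[OF assms(1), of "t - x" 1 "zeta 1" "zeta 2"] assms(2) by (simp add: norm_zeta)
  then have "norm (psi_integrand q l f x t) \<le> 1 / (3 * (norm l)\<^sup>2) * (3 * (\<bar>q t\<bar> * B))"
    unfolding psi_integrand_eq[OF l] norm_mult
    using assms by (intro mult_mono) (auto simp: norm_divide norm_mult norm_power)
  also have "\<dots> = (\<bar>q t\<bar> * B) / (norm l)\<^sup>2" by simp
  also have "\<dots> \<le> (\<bar>q t\<bar> * B) / m\<^sup>2"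
    using assms B by (intro divide_left_mono power_mono mult_pos_pos zero_less_power) auto
  finally show ?thesis by (simp add: mult.commute)
qed

text \<open>Both sides of the recursion converge. Dominated convergence applies under the integral
  because the approximations are bounded uniformly in \<open>n\<close> for fixed
  \<open>l\<close>.\<close>

lemma solves_psi_equation_psi0:
  assumes "l \<in> Omega0"
  shows "solves_psi_equation q l (psi0 q l)"
  unfolding solves_psi_equation_def
proof (intro allI conjI)
  fix x
  have l: "norm l > 0" using Omega0_D assms by simp
  note i = psi_map_eq(1)[OF assms admissible_psi0[OF assms], of x]
  show "set_integrable lebesgue {x..} (psi_integrand q l (psi0 q l) x)" by (rule i)
  let ?B = "exp (q1 / (norm l)\<^sup>2) / (norm l)\<^sup>2"
  have "(\<lambda>n. LINT t:{x..}|lebesgue. psi_integrand q l (psi_approx q l n) x t) \<longlonglongrightarrow>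
        (LINT t:{x..}|lebesgue. psi_integrand q l (psi0 q l) x t)"
    unfolding set_lebesgue_integral_def
  proof (rule integral_dominated_convergence[where w = "\<lambda>t. ?B * \<bar>q t\<bar>"])
    show "(\<lambda>t. indicator {x..} t *\<^sub>R psi_integrand q l (psi0 q l) x t) \<in> borel_measurable lebesgue"
      "(\<lambda>t. indicator {x..} t *\<^sub>R psi_integrand q l (psi_approx q l n) x t) \<in> borel_measurable lebesgue" for n
      using i psi_map_eq(1)[OF assms admissible_psi_approx[OF assms], of x] by (auto simp: set_integrable_def)
    show "integrable lebesgue (\<lambda>t. ?B * \<bar>q t\<bar>)" using integrable_q by simp
    show "AE t in lebesgue. (\<lambda>n. indicator {x..} t *\<^sub>R psi_integrand q l (psi_approx q l n) x t)
        \<longlonglongrightarrow> indicator {x..} t *\<^sub>R psi_integrand q l (psi0 q l) x t"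
      unfolding psi_integrand_def by (intro AE_I2 tendsto_intros psi_approx_LIMSEQ assms)
    show "AE t in lebesgue. norm (indicator {x..} t *\<^sub>R psi_integrand q l (psi_approx q l n) x t) \<le> ?B * \<bar>q t\<bar>" for n
      using norm_psi_integrand_le[OF assms _ l order_refl norm_psi_approx_le[OF assms l order_refl]]
      by (intro AE_I2) (auto simp: indicator_def)
  qed
  then have "(\<lambda>n. psi_approx q l (Suc n) x) \<longlonglongrightarrow> psi_map q l (psi0 q l) x"
    by (auto simp: psi_map_def intro!: tendsto_intros)
  then show "psi0 q l x = psi_map q l (psi0 q l) x"
    using LIMSEQ_Suc[OF psi_approx_LIMSEQ(1)[OF assms, of x]] LIMSEQ_unique by blast
qed

text \<open>Each approximation is a parameter integral over the previous one. Near \<open>z0\<close>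
  the lower bound \<open>norm z0 / 2\<close> on \<open>norm z\<close> gives a majorant independent
  of \<open>z\<close>.\<close>

lemma holomorphic_psi_approx: "(\<lambda>l. psi_approx q l n x) holomorphic_on Omega0"
proof (induction n arbitrary: x)
  case 0
  then show ?case by simp
next
  case (Suc n)
  have "(\<lambda>l. \<integral>t. indicator {x..} t *\<^sub>R psi_integrand q l (psi_approx q l n) x t \<partial>lebesgue) holomorphic_on Omega0"
  proof (rule holomorphic_on_lebesgue_integral[OF open_Omega0])
    show "(\<lambda>l. indicator {x..} t *\<^sub>R psi_integrand q l (psi_approx q l n) x t) holomorphic_on Omega0" for t
      unfolding psi_integrand_def s2_def scaleR_conv_of_real
      by (intro holomorphic_intros Suc.IH) (auto dest: Omega0_D)
    show "(\<lambda>t. indicator {x..} t *\<^sub>R psi_integrand q l (psi_approx q l n) x t) \<in> borel_measurable lebesgue"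
      if "l \<in> Omega0" for l
      using psi_map_eq(1)[OF that admissible_psi_approx[OF that], of x] by (auto simp: set_integrable_def)
    fix z0 assume z0: "z0 \<in> Omega0"
    obtain \<rho> where \<rho>: "\<rho> > 0" "cball z0 \<rho> \<subseteq> Omega0" "\<And>z. z \<in> cball z0 \<rho> \<Longrightarrow> norm z \<ge> norm z0 / 2"
      using Omega0_ball[OF z0] by metis
    have m: "norm z0 / 2 > 0" using Omega0_D z0 by simp
    let ?B = "exp (q1 / (norm z0 / 2)\<^sup>2) / (norm z0 / 2)\<^sup>2"
    have "norm (indicator {x..} t *\<^sub>R psi_integrand q z (psi_approx q z n) x t) \<le> ?B * \<bar>q t\<bar>" if "z \<in> ball z0 \<rho>" for z t
    proof -
      have z: "z \<in> Omega0" "norm z0 / 2 \<le> norm z" using that \<rho> by auto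
      show ?thesis
        using norm_psi_integrand_le[OF z(1) _ m z(2) norm_psi_approx_le[OF z(1) m z(2)]]
        by (auto simp: indicator_def)
    qed
    moreover have "integrable lebesgue (\<lambda>t. ?B * \<bar>q t\<bar>)" using integrable_q by simp
    moreover have "ball z0 \<rho> \<subseteq> Omega0" using \<rho> by auto
    ultimately show "\<exists>\<rho>>0. \<exists>g. ball z0 \<rho> \<subseteq> Omega0 \<and> integrable lebesgue g \<and>
          (\<forall>z\<in>ball z0 \<rho>. \<forall>t\<in>space lebesgue. norm (indicator {x..} t *\<^sub>R psi_integrand q z (psi_approx q z n) x t) \<le> g t)"
      using \<rho>(1) by blast
  qed
  then show ?case
    by (auto simp: psi_map_def set_lebesgue_integral_def intro!: holomorphic_intros)
qed

text \<open>Locally uniform limits of holomorphic functions are holomorphic.\<close>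

lemma analytic_psi0: "(\<lambda>l. psi0 q l x) analytic_on Omega0"
  unfolding analytic_on_open[OF open_Omega0]
proof (rule holomorphic_uniform_sequence[OF open_Omega0 holomorphic_psi_approx])
  fix z0 assume z0: "z0 \<in> Omega0"
  obtain \<rho> where \<rho>: "\<rho> > 0" "cball z0 \<rho> \<subseteq> Omega0" "\<And>z. z \<in> cball z0 \<rho> \<Longrightarrow> norm z \<ge> norm z0 / 2"
    using Omega0_ball[OF z0] by metis
  have m: "norm z0 / 2 > 0" using Omega0_D z0 by simp
  have "uniform_limit (cball z0 \<rho>) (\<lambda>n l. psi_approx q l n x) (\<lambda>l. psi0 q l x) sequentially"
    using \<rho> by (intro uniform_limit_psi_approx[OF m, where x = "\<lambda>_. x"]) auto
  then show "\<exists>d>0. cball z0 d \<subseteq> Omega0 \<and> uniform_limit (cball z0 d) (\<lambda>n l. psi_approx q l n x) (\<lambda>l. psi0 q l x) sequentially"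
    using \<rho> by blast
qed

end

section \<open>Norms of the potential\<close>

lemma Lnorm_1: "Lnorm 1 f = (LINT t|lebesgue. \<bar>f t\<bar>)"
  by (simp add: Lnorm_def Bochner_Integration.integral_nonneg)

lemma Lnorm_2: "Lnorm 2 f = sqrt (LINT t|lebesgue. (f t)\<^sup>2)"
proof -
  have "\<bar>f t\<bar> powr 2 = (f t)\<^sup>2" for t
    by (cases "f t = 0") (simp_all add: powr_numeral)
  then show ?thesis
    by (simp add: Lnorm_def powr_half_sqrt Bochner_Integration.integral_nonneg)
qed

text \<open>Source of the strict inequalities of the theorem: their right-hand sides vanish when
  \<open>q\<close> is zero almost everywhere.\<close>

lemma Lnorm_pos:
  assumes "integrable lebesgue f" "integrable lebesgue (\<lambda>t. (f t)\<^sup>2)" "\<not> (AE t in lebesgue. f t = 0)"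
  shows "Lnorm 1 f > 0" "Lnorm 2 f > 0"
proof -
  have "(LINT t|lebesgue. \<bar>f t\<bar>) \<noteq> 0"
    using assms by (subst integral_nonneg_eq_0_iff_AE) auto
  then show "Lnorm 1 f > 0"
    unfolding Lnorm_1 by (simp add: order_less_le Bochner_Integration.integral_nonneg)
  have "(LINT t|lebesgue. (f t)\<^sup>2) \<noteq> 0"
    using assms by (subst integral_nonneg_eq_0_iff_AE) auto
  then show "Lnorm 2 f > 0"
    unfolding Lnorm_2 by (simp add: order_less_le Bochner_Integration.integral_nonneg)
qed

lemma has_bochner_integral_exp_tail:
  assumes "k > (0::real)"
  shows "has_bochner_integral lebesgue (\<lambda>t. indicator {x..} t * exp (- k * (t - x))) (1 / k)"
proof -
  have m[measurable]: "(\<lambda>t. indicator {x..} t * exp (- k * (t - x))) \<in> borel_measurable lborel"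
    by measurable
  have "((\<lambda>t. - exp (- k * (t - x)) / k) \<longlongrightarrow> - 0 / k) at_top"
  proof (intro tendsto_intros filterlim_compose[OF exp_at_bot])
    show "filterlim (\<lambda>t. - k * (t - x)) at_bot at_top"
      using assms filterlim_tendsto_add_at_top[OF tendsto_const[of "- x"] filterlim_ident]
      by (intro filterlim_tendsto_neg_mult_at_bot[OF tendsto_const]) auto
  qed (use assms in auto)
  then have "(\<integral>\<^sup>+t. ennreal (exp (- k * (t - x))) * indicator {x..} t \<partial>lborel) = 0 - (- exp (- k * (x - x)) / k)"
    using assms by (intro nn_integral_FTC_atLeast) (auto intro!: derivative_eq_intros simp: field_simps)
  moreover have "(\<integral>\<^sup>+t. ennreal (exp (- k * (t - x))) * indicator {x..} t \<partial>lborel)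
      = (\<integral>\<^sup>+t. ennreal (indicator {x..} t * exp (- k * (t - x))) \<partial>lborel)"
    by (intro nn_integral_cong) (auto simp: indicator_def)
  ultimately have "(\<integral>\<^sup>+t. ennreal (indicator {x..} t * exp (- k * (t - x))) \<partial>lebesgue) = ennreal (1 / k)"
    by (simp add: nn_integral_completion)
  then show ?thesis
    using assms m by (intro has_bochner_integral_nn_integral) (auto intro: measurable_completion)
qed

lemma integrable_exp_abs:
  assumes "k > (0::real)"
  shows "integrable lebesgue (\<lambda>t. exp (- k * \<bar>t\<bar>))"
proof -
  let ?f = "\<lambda>t. indicator {0..} t * exp (- k * t)"
  have f: "integrable lborel ?f"
    using has_bochner_integral_exp_tail[OF assms, of 0]
    by (subst integrable_completion[symmetric]) (auto simp: has_bochner_integral_iff)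
  \<comment> \<open>Adding the reflected function dominates the two-sided exponential; the sum is
    twice as large at \<open>t = 0\<close>.\<close>
  then have "integrable lborel (\<lambda>t. ?f t + ?f (0 + -1 * t))"
    by (intro Bochner_Integration.integrable_add lborel_integrable_real_affine) auto
  then have "integrable lborel (\<lambda>t. exp (- k * \<bar>t\<bar>))"
    by (rule Bochner_Integration.integrable_bound) (auto simp: indicator_def)
  then show ?thesis
    by (subst integrable_completion) auto
qed

text \<open>The weight is at least \<open>1\<close>, which settles the square. For \<open>f\<close>
  itself, write \<open>\<bar>f x\<bar>\<close> as the product of
  \<open>\<bar>f x\<bar> * exp (a * \<bar>x\<bar>)\<close> and
  \<open>exp (- a * \<bar>x\<bar>)\<close> and bound it by the squares.\<close>

lemma integrable_weighted_square:
  fixes f :: "real \<Rightarrow> real"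
  assumes "a > 0" "f \<in> borel_measurable lebesgue" "integrable lebesgue (\<lambda>x. \<bar>f x\<bar>\<^sup>2 * exp (2 * a * \<bar>x\<bar>))"
  shows "integrable lebesgue f" "integrable lebesgue (\<lambda>x. (f x)\<^sup>2)"
proof -
  show "integrable lebesgue (\<lambda>x. (f x)\<^sup>2)"
    using assms mult_left_mono[of 1 "exp (2 * a * \<bar>x\<bar>)" "(f x)\<^sup>2" for x :: real]
    by (intro Bochner_Integration.integrable_bound[OF assms(3)]) auto
  have "integrable lebesgue (\<lambda>x. \<bar>f x\<bar>\<^sup>2 * exp (2 * a * \<bar>x\<bar>) + exp (- (2 * a) * \<bar>x\<bar>))"
    using assms by (intro Bochner_Integration.integrable_add integrable_exp_abs) auto
  then show "integrable lebesgue f"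
  proof (rule Bochner_Integration.integrable_bound)
    have "\<bar>f x\<bar> \<le> \<bar>f x\<bar>\<^sup>2 * exp (2 * a * \<bar>x\<bar>) + exp (- (2 * a) * \<bar>x\<bar>)" for x
    proof -
      let ?e = "exp (a * \<bar>x\<bar>)"
      have e: "exp (2 * a * \<bar>x\<bar>) = ?e\<^sup>2" "exp (- (2 * a) * \<bar>x\<bar>) = (1 / ?e)\<^sup>2"
        by (simp_all add: power2_eq_square exp_minus field_simps flip: exp_add)
      have "2 * (\<bar>f x\<bar> * ?e) * (1 / ?e) \<le> (\<bar>f x\<bar> * ?e)\<^sup>2 + (1 / ?e)\<^sup>2"
        by (rule sum_squares_bound)
      moreover have "2 * (\<bar>f x\<bar> * ?e) * (1 / ?e) = 2 * \<bar>f x\<bar>" by simp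
      ultimately show ?thesis unfolding e by (simp add: power_mult_distrib)
    qed
    then show "AE x in lebesgue. norm (f x) \<le> norm (\<bar>f x\<bar>\<^sup>2 * exp (2 * a * \<bar>x\<bar>) + exp (- (2 * a) * \<bar>x\<bar>))"
      by (intro AE_I2) (smt (verit) real_norm_def)
  qed fact
qed

text \<open>Cauchy--Schwarz for \<open>q\<close> against the exponentially decaying kernel, in the form
  \<open>2 e \<bar>q\<bar> \<le> \<epsilon> q\<^sup>2 + e\<^sup>2 / \<epsilon>\<close> with \<open>\<epsilon> = \<delta> / q\<^sub>2\<close>.\<close>

lemma norm_kern_0_integral_le:
  assumes l: "l \<in> Omega0" and q: "integrable lebesgue (\<lambda>t. (q t)\<^sup>2)" "q \<in> borel_measurable lebesgue"
    and ab: "norm a \<le> 1" "norm b \<le> 1"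
  shows "norm (LINT t:{x..}|lebesgue. kern 0 a b l (t - x) * of_real (q t)) \<le> 2 * (Lnorm 2 q * delta l)"
\<comment> \<open>The choice of \<open>\<epsilon>\<close> divides by \<open>Lnorm 2 q\<close>, so a
  potential vanishing almost everywhere is treated apart.\<close>
proof (cases "Lnorm 2 q = 0")
  case True
  then have "AE t in lebesgue. (q t)\<^sup>2 = 0"
    using q by (subst (asm) Lnorm_2) (simp add: integral_nonneg_eq_0_iff_AE)
  then have "(LINT t:{x..}|lebesgue. kern 0 a b l (t - x) * of_real (q t)) = 0"
    unfolding set_lebesgue_integral_def by (intro integral_eq_zero_AE) auto
  then show ?thesis using True by simp
next
  case False
  define m where "m = Im l * sqrt 3 - \<bar>Re l\<bar>"
  define \<epsilon> where "\<epsilon> = delta l / Lnorm 2 q"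
  have m: "m > 0" using Omega0_D[OF l] by (simp add: m_def)
  have \<delta>: "delta l > 0" "m = 1 / (delta l)\<^sup>2"
    using m by (simp_all add: delta_def m_def[symmetric] powr_minus powr_half_sqrt field_simps)
  have q2: "Lnorm 2 q > 0" "(LINT t|lebesgue. (q t)\<^sup>2) = (Lnorm 2 q)\<^sup>2"
    using False by (auto simp: Lnorm_2 order_less_le Bochner_Integration.integral_nonneg)
  have \<epsilon>: "\<epsilon> > 0" using \<delta> q2 by (simp add: \<epsilon>_def)
  define E where "E t = exp (- (sqrt 3 * m) * (t - x))" for t
  have hE: "has_bochner_integral lebesgue (\<lambda>t. indicator {x..} t * E t) (1 / (sqrt 3 * m))"
    unfolding E_def using m by (intro has_bochner_integral_exp_tail) simp
  have i1: "integrable lebesgue (\<lambda>t. indicator {x..} t * (\<epsilon> * (q t)\<^sup>2))"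
    using q by (intro integrable_mult_indicator[of "{x..}" lebesgue "\<lambda>t. \<epsilon> * (q t)\<^sup>2", simplified]) auto
  have i2: "integrable lebesgue (\<lambda>t. (indicator {x..} t * E t) / \<epsilon>)"
    using hE by (auto simp: has_bochner_integral_iff)
  have "norm (LINT t:{x..}|lebesgue. kern 0 a b l (t - x) * of_real (q t)) \<le> (LINT t:{x..}|lebesgue. \<epsilon> * (q t)\<^sup>2 + E t / \<epsilon>)"
  proof (rule set_integral_norm_le)
    show "set_integrable lebesgue {x..} (\<lambda>t. \<epsilon> * (q t)\<^sup>2 + E t / \<epsilon>)"
      using Bochner_Integration.integrable_add[OF i1 i2] by (simp add: set_integrable_def distrib_left)
    fix t assume t: "t \<in> {x..}"
    \<comment> \<open>\<open>e\<close> dominates both exponentials for \<open>t \<ge> x\<close>;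
      \<open>E t\<close> is its square and so has twice the rate.\<close>
    define e where "e = exp (- (sqrt 3 * m / 2) * (t - x))"
    have ek: "norm (exp (mu k l * of_real (t - x))) \<le> e" if "k \<in> {1, 2}" for k
      using mult_right_mono[OF Re_mu_le[OF that, of l], of "t - x"] t by (simp add: e_def m_def)
    have "norm (kern 0 a b l (t - x)) \<le> norm a * norm (exp (mu 1 l * of_real (t - x))) + norm b * norm (exp (mu 2 l * of_real (t - x)))"
      unfolding kern_def by (auto simp: norm_mult simp del: norm_exp_eq_Re One_nat_def intro!: norm_triangle_le)
    also have "\<dots> \<le> 1 * e + 1 * e"
      using ab by (intro add_mono mult_mono ek) auto
    finally have "norm (kern 0 a b l (t - x) * of_real (q t)) \<le> 2 * e * \<bar>q t\<bar>"
      by (simp add: norm_mult mult_right_mono)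
    also have "\<dots> = 2 * (sqrt \<epsilon> * \<bar>q t\<bar>) * (e / sqrt \<epsilon>)"
      using \<epsilon> by simp
    also have "\<dots> \<le> (sqrt \<epsilon> * \<bar>q t\<bar>)\<^sup>2 + (e / sqrt \<epsilon>)\<^sup>2"
      by (rule sum_squares_bound)
    also have "\<dots> = \<epsilon> * (q t)\<^sup>2 + E t / \<epsilon>"
      using \<epsilon> by (simp add: power_mult_distrib power_divide E_def e_def flip: exp_double)
    finally show "norm (kern 0 a b l (t - x) * of_real (q t)) \<le> \<epsilon> * (q t)\<^sup>2 + E t / \<epsilon>" .
  qed
  also have "\<dots> = (LINT t|lebesgue. indicator {x..} t * (\<epsilon> * (q t)\<^sup>2)) + (LINT t|lebesgue. (indicator {x..} t * E t) / \<epsilon>)"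
    by (subst Bochner_Integration.integral_add[OF i1 i2, symmetric]) (simp add: set_lebesgue_integral_def distrib_left)
  also have "(LINT t|lebesgue. (indicator {x..} t * E t) / \<epsilon>) = 1 / (sqrt 3 * m) / \<epsilon>"
    using has_bochner_integral_integral_eq[OF hE] by simp
  also have "(LINT t|lebesgue. indicator {x..} t * (\<epsilon> * (q t)\<^sup>2)) \<le> (LINT t|lebesgue. \<epsilon> * (q t)\<^sup>2)"
    using q \<epsilon> by (intro integral_mono') (auto simp: indicator_def)
  also have "\<dots> = \<epsilon> * (Lnorm 2 q)\<^sup>2" by (simp add: q2)
  \<comment> \<open>Dropping \<open>sqrt 3\<close> is affordable: the resulting constant
    \<open>2\<close> is still below the \<open>3\<close> in the prefactors.\<close>
  also have "1 / (sqrt 3 * m) / \<epsilon> \<le> 1 / (1 * m) / \<epsilon>"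
    using m \<epsilon> by (intro divide_right_mono divide_left_mono mult_right_mono) auto
  \<comment> \<open>With this \<open>\<epsilon>\<close> and \<open>m = 1 / (delta l)\<^sup>2\<close>
    both summands equal \<open>Lnorm 2 q * delta l\<close>.\<close>
  also have "\<epsilon> * (Lnorm 2 q)\<^sup>2 + 1 / (1 * m) / \<epsilon> = 2 * (Lnorm 2 q * delta l)"
    using \<delta> q2(1) by (simp add: \<epsilon>_def power2_eq_square)
  finally show ?thesis by simp
qed

text \<open>The reciprocal of \<open>1 - y \<le> exp (- y)\<close>. Strictness comes from squaring
  \<open>1 - y / 2 \<le> exp (- y / 2)\<close>, as the square on the left exceeds
  \<open>1 - y\<close> by \<open>y\<^sup>2 / 4\<close>.\<close>

lemma exp_minus_1_le:
  assumes "0 \<le> y" "y < (1::real)"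
  shows "exp y - 1 \<le> y * inverse (1 - y)" "y > 0 \<Longrightarrow> exp y - 1 < y * inverse (1 - y)"
proof -
  have e: "y * inverse (1 - y) = 1 / (1 - y) - 1" using assms by (simp add: field_simps)
  have *: "exp y = 1 / exp (- y)" by (simp add: exp_minus field_simps)
  have "1 - y \<le> exp (- y)" using exp_ge_add_one_self[of "- y"] by simp
  then show "exp y - 1 \<le> y * inverse (1 - y)"
    using assms unfolding e * by (auto intro!: divide_left_mono)
  assume "y > 0"
  have "1 - y < (1 - y / 2)\<^sup>2" using \<open>y > 0\<close> by (simp add: power2_eq_square field_simps)
  also have "\<dots> \<le> (exp (- y / 2))\<^sup>2"
    using assms exp_ge_add_one_self[of "- y / 2"] by (intro power_mono) auto
  also have "\<dots> = exp (- y)" by (simp flip: exp_double)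
  finally show "exp y - 1 < y * inverse (1 - y)"
    using assms unfolding e * by (auto intro!: divide_strict_left_mono)
qed

section \<open>Derivatives and remainders\<close>

lemma has_vector_derivative_mult_exp:
  fixes u :: "real \<Rightarrow> complex"
  assumes "(u has_vector_derivative u') (at x)"
  shows "((\<lambda>x. u x * exp (c * of_real x)) has_vector_derivative (u' + c * u x) * exp (c * of_real x)) (at x)"
proof -
  have "((\<lambda>x. exp (c * of_real x)) has_vector_derivative c * exp (c * of_real x)) (at x)"
    by (rule has_vector_derivative_real_field[where f = "\<lambda>z. exp (c * z)"]) (auto intro!: derivative_eq_intros)
  from has_vector_derivative_mult[OF assms this] show ?thesis
    by (simp add: algebra_simps)
qed

context integrable_potential
begin

text \<open>After the exponential factor is removed, \<open>v0\<close> and its first two derivatives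
  are affine combinations of these three functions, so differentiation acts on coefficients
  only.\<close>

definition T :: "complex \<Rightarrow> nat \<Rightarrow> real \<Rightarrow> complex" where
  "T l k = tail_exp (mu k l) (\<lambda>t. of_real (q t) * psi0 q l t)"

lemma T_combination_has_vector_derivative:
  assumes "l \<in> Omega0" "c + a + b = 0"
  shows "((\<lambda>x. c * T l 0 x + a * T l 1 x + b * T l 2 x) has_vector_derivative
           - (a * mu 1 l * T l 1 x + b * mu 2 l * T l 2 x)) (at x)"
  using tail_exp_combination_has_vector_derivative[OF assms(1) integrable_q_mult[OF admissible_psi0[OF assms(1)]] assms(2)]
  by (simp add: T_def del: One_nat_def)

lemma psi0_eq_T:
  assumes "l \<in> Omega0"
  shows "psi0 q l x = 1 + \<i> / (3 * l\<^sup>2) * (1 * T l 0 x + zeta 1 * T l 1 x + zeta 2 * T l 2 x)"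
  using solves_psi_equation_psi0[OF assms] psi_map_eq(3)[OF assms admissible_psi0[OF assms], of x]
  by (simp add: solves_psi_equation_def T_def del: One_nat_def)

lemma mu_eq: "mu k l = \<i> * l * (1 - zeta k)"
  by (simp add: mu_def)

text \<open>The tail contributes \<open>- mu k l\<close> and the exponential factor
  \<open>\<i> * l\<close>, together \<open>\<i> * l * zeta k\<close>. The coefficient
  \<open>zeta k\<close> becomes its square, the other nonreal root, so the coefficients again sum to
  \<open>0\<close>.\<close>

lemma v0_has_vector_derivative:
  assumes "l \<in> Omega0"
  shows "(v0 q l has_vector_derivative
      (\<i> * l - 1 / (3 * l) * (1 * T l 0 x + zeta 2 * T l 1 x + zeta 1 * T l 2 x)) * exp (\<i> * l * of_real x)) (at x)"
proof -
  have l: "l \<noteq> 0" using Omega0_D assms by blast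
  have z: "1 + zeta 1 + zeta 2 = 0" using zeta_simps(1) by (simp add: add.assoc)
  have "((\<lambda>x. 1 + \<i> / (3 * l\<^sup>2) * (1 * T l 0 x + zeta 1 * T l 1 x + zeta 2 * T l 2 x)) has_vector_derivative
      0 + \<i> / (3 * l\<^sup>2) * - (zeta 1 * mu 1 l * T l 1 x + zeta 2 * mu 2 l * T l 2 x)) (at x)"
    by (intro has_vector_derivative_add has_vector_derivative_const has_vector_derivative_mult_right T_combination_has_vector_derivative assms z)
  then have "(psi0 q l has_vector_derivative 
      0 + \<i> / (3 * l\<^sup>2) * - (zeta 1 * mu 1 l * T l 1 x + zeta 2 * mu 2 l * T l 2 x)) (at x)"
    unfolding psi0_eq_T[OF assms, symmetric] .
  from has_vector_derivative_mult_exp[OF this, of "\<i> * l"]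
  have "(v0 q l has_vector_derivative (0 + \<i> / (3 * l\<^sup>2) * - (zeta 1 * mu 1 l * T l 1 x + zeta 2 * mu 2 l * T l 2 x) + \<i> * l * psi0 q l x)
      * exp (\<i> * l * of_real x)) (at x)"
    by (simp add: v0_def[abs_def] del: One_nat_def)
  also have "0 + \<i> / (3 * l\<^sup>2) * - (zeta 1 * mu 1 l * T l 1 x + zeta 2 * mu 2 l * T l 2 x) + \<i> * l * psi0 q l x
     = \<i> * l + \<i> * \<i> / (3 * l) * (T l 0 x + zeta 1 * zeta 1 * T l 1 x + zeta 2 * zeta 2 * T l 2 x)"
    unfolding psi0_eq_T[OF assms] mu_eq using l by (simp add: field_simps power2_eq_square del: One_nat_def)
  finally show ?thesis
    using zeta_simps by (simp del: One_nat_def)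
qed

lemma v0'_eq:
  assumes "l \<in> Omega0"
  shows "v0' q l x = (\<i> * l - 1 / (3 * l) * (1 * T l 0 x + zeta 2 * T l 1 x + zeta 1 * T l 2 x)) * exp (\<i> * l * of_real x)"
  unfolding v0'_def by (rule vector_derivative_at[OF v0_has_vector_derivative[OF assms]])

text \<open>A further factor \<open>\<i> * l * zeta k\<close> turns the coefficients into cubes of
  roots of unity, hence into \<open>1\<close>.\<close>

lemma v0'_has_vector_derivative:
  assumes "l \<in> Omega0"
  shows "(v0' q l has_vector_derivative
      ((\<i> * l)\<^sup>2 - \<i> / 3 * (1 * T l 0 x + 1 * T l 1 x + 1 * T l 2 x)) * exp (\<i> * l * of_real x)) (at x)"
proof -
  have l: "l \<noteq> 0" using Omega0_D assms by blast
  have z: "1 + zeta 2 + zeta 1 = 0" using zeta_simps(1) by (simp add: add.commute add.left_commute)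
  let ?u = "\<lambda>x. \<i> * l - 1 / (3 * l) * (1 * T l 0 x + zeta 2 * T l 1 x + zeta 1 * T l 2 x)"
  let ?u' = "0 - 1 / (3 * l) * - (zeta 2 * mu 1 l * T l 1 x + zeta 1 * mu 2 l * T l 2 x)"
  have "(?u has_vector_derivative ?u') (at x)"
    by (intro has_vector_derivative_diff has_vector_derivative_const has_vector_derivative_mult_right T_combination_has_vector_derivative assms z)
  from has_vector_derivative_mult_exp[OF this, of "\<i> * l"]
  have "(v0' q l has_vector_derivative (?u' + \<i> * l * ?u x) * exp (\<i> * l * of_real x)) (at x)"
    unfolding v0'_eq[OF assms, symmetric] .
  also have "?u' + \<i> * l * ?u x = (\<i> * l)\<^sup>2 - \<i> / 3 * (T l 0 x + (zeta 2 * zeta 1) * T l 1 x + (zeta 1 * zeta 2) * T l 2 x)"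
    unfolding mu_eq using l by (simp add: field_simps power2_eq_square del: One_nat_def)
  finally show ?thesis
    using zeta_simps by (simp del: One_nat_def)
qed

lemma v0''_eq:
  assumes "l \<in> Omega0"
  shows "v0'' q l x = ((\<i> * l)\<^sup>2 - \<i> / 3 * (1 * T l 0 x + 1 * T l 1 x + 1 * T l 2 x)) * exp (\<i> * l * of_real x)"
  unfolding v0''_def by (rule vector_derivative_at[OF v0'_has_vector_derivative[OF assms]])

section \<open>Leading terms and bounds for the remainders\<close>

definition C_int :: "complex \<Rightarrow> complex \<Rightarrow> complex \<Rightarrow> real \<Rightarrow> complex" where
  "C_int a b l x = (LINT t:{x..}|lebesgue. kern 1 a b l (t - x) * (of_real (q t) * (psi0 q l t - 1)))"

text \<open>The constant \<open>0\<close> appears because the constant part of the kernel against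
  \<open>q\<close> is the leading term; what is left decays and produces
  \<open>delta\<close>.\<close>

definition D_int :: "complex \<Rightarrow> complex \<Rightarrow> complex \<Rightarrow> real \<Rightarrow> complex" where
  "D_int a b l x = (LINT t:{x..}|lebesgue. kern 0 a b l (t - x) * of_real (q t))"

lemma T_combination_split:
  assumes "l \<in> Omega0"
  shows "1 * T l 0 x + a * T l 1 x + b * T l 2 x = of_real (LINT t:{x..}|lebesgue. q t) + C_int a b l x + D_int a b l x"
proof -
  have 1: "integrable lebesgue (\<lambda>t. of_real (q t) * psi0 q l t)"
    by (intro integrable_q_mult admissible_psi0 assms)
  have 2: "integrable lebesgue (\<lambda>t. complex_of_real (q t))" using integrable_q by simp
  have 3: "integrable lebesgue (\<lambda>t. of_real (q t) * (psi0 q l t - 1))"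
    using Bochner_Integration.integrable_diff[OF 1 2] by (simp add: right_diff_distrib)
  have "1 * T l 0 x + a * T l 1 x + b * T l 2 x = (LINT t:{x..}|lebesgue. kern 1 a b l (t - x) * (of_real (q t) * psi0 q l t))"
    unfolding T_def mu_0 set_integrable_kern(2)[OF assms 1] ..
  \<comment> \<open>\<open>q\<close> times \<open>psi0\<close> is split at \<open>psi0 = 1\<close>,
    and the kernel multiplying \<open>q\<close> alone is split into its constant and its
    exponentials.\<close>
  also have "\<dots> = (LINT t:{x..}|lebesgue. (kern 1 0 0 l (t - x) * of_real (q t) + kern 1 a b l (t - x) * (of_real (q t) * (psi0 q l t - 1)))
        + kern 0 a b l (t - x) * of_real (q t))"
    by (rule arg_cong[where f = "set_lebesgue_integral _ _"]) (auto simp: kern_def algebra_simps)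
  also have "\<dots> = (LINT t:{x..}|lebesgue. kern 1 0 0 l (t - x) * of_real (q t)) + C_int a b l x + D_int a b l x"
    unfolding C_int_def D_int_def
    by (simp only: set_integral_add set_integrable_kern(1)[OF assms 2] set_integrable_kern(1)[OF assms 3])
  also have "(LINT t:{x..}|lebesgue. kern 1 0 0 l (t - x) * of_real (q t)) = of_real (LINT t:{x..}|lebesgue. q t)"
    by (simp add: kern_def set_integral_complex_of_real)
  finally show ?thesis .
qed

lemma r_eq: "r q l = q1 / (norm l)\<^sup>2"
  by (simp add: r_def Lnorm_1 q1_def)

lemma norm_C_int_le:
  assumes "l \<in> Omega0" "norm a \<le> 1" "norm b \<le> 1"
  shows "norm (C_int a b l x) \<le> 3 * (q1 * (exp (r q l) - 1))"
proof -
  have "norm (C_int a b l x) \<le> 3 * (LINT t:{x..}|lebesgue. \<bar>q t\<bar> * (exp (r q l) - 1))"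
    unfolding C_int_def
  proof (rule norm_kern_integral_le[OF assms(1) set_integrable_abs_q_const _ assms(2,3)])
    fix t
    have "Q t / (norm l)\<^sup>2 \<le> r q l"
      unfolding r_eq by (intro divide_right_mono Q_le_q1) auto
    then show "norm (psi0 q l t - 1) \<le> exp (r q l) - 1"
      using norm_psi0_minus_1_le[OF assms(1), of t] by (simp add: order_trans)
  qed
  also have "\<dots> = 3 * (Q x * (exp (r q l) - 1))" by (simp add: Q_def)
  also have "\<dots> \<le> 3 * (q1 * (exp (r q l) - 1))"
    using Q_le_q1[of x] q1_nonneg by (intro mult_left_mono mult_right_mono) (auto simp: r_eq)
  finally show ?thesis .
qed

text \<open>Index \<open>0\<close> is the prescribed function. From one \<open>k\<close> to the next
  the prefactor is multiplied by \<open>\<i> * l\<close>, starting at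
  \<open>\<i> / (3 * l\<^sup>2)\<close>.\<close>

definition C_rem :: "nat \<Rightarrow> complex \<Rightarrow> real \<Rightarrow> complex" where
  "C_rem k = (if k = 0 then C0 q else if k = 1 then (\<lambda>l x. - 1 / (3 * l) * C_int (zeta 2) (zeta 1) l x)
     else (\<lambda>l x. - \<i> / 3 * C_int 1 1 l x))"

definition D_rem :: "nat \<Rightarrow> complex \<Rightarrow> real \<Rightarrow> complex" where
  "D_rem k = (if k = 0 then D0 q else if k = 1 then (\<lambda>l x. - 1 / (3 * l) * D_int (zeta 2) (zeta 1) l x)
     else (\<lambda>l x. - \<i> / 3 * D_int 1 1 l x))"

lemma C0_eq: "C0 q l x = \<i> / (3 * l\<^sup>2) * C_int (zeta 1) (zeta 2) l x"
  by (simp add: C0_def C_int_def kern_def mu_def mult.assoc del: One_nat_def)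

lemma D0_eq: "D0 q l x = \<i> / (3 * l\<^sup>2) * D_int (zeta 1) (zeta 2) l x"
  by (simp add: D0_def D_int_def kern_def mu_def mult.assoc del: One_nat_def)

text \<open>A common shape for \<open>k = 0, 1, 2\<close>, so that each bound is proved
  once.\<close>

lemma rem_form:
  assumes "l \<in> Omega0" "k \<le> 2"
  obtains c a b where "norm c = norm l powi (int k - 2) / 3" "norm a = 1" "norm b = 1"
    "\<And>x. C_rem k l x = c * C_int a b l x" "\<And>x. D_rem k l x = c * D_int a b l x"
proof -
  have l: "norm l > 0" using Omega0_D assms by simp
  consider "k = 0" | "k = 1" | "k = 2" using assms(2) by linarith
  then show ?thesis
  proof cases
    case 1
    show ?thesis
      by (rule that[of "\<i> / (3 * l\<^sup>2)" "zeta 1" "zeta 2"])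
         (simp_all add: 1 norm_zeta C_rem_def D_rem_def C0_eq D0_eq norm_divide norm_mult norm_power power_int_minus field_simps)
  next
    case 2
    show ?thesis
      by (rule that[of "- 1 / (3 * l)" "zeta 2" "zeta 1"])
         (simp_all add: 2 norm_zeta C_rem_def D_rem_def norm_divide norm_mult norm_power power_int_minus field_simps)
  next
    case 3
    show ?thesis
      by (rule that[of "- \<i> / 3" 1 1])
         (simp_all add: 3 C_rem_def D_rem_def norm_divide)
  qed
qed

text \<open>The prefactor absorbs the \<open>3\<close>, and \<open>q1\<close> is
  \<open>r q l\<close> times \<open>(norm l)\<^sup>2\<close>; this leaves
  \<open>norm l ^ k * r * (exp r - 1)\<close> with \<open>r = r q l\<close>.\<close>

lemma C_rem_bound:
  assumes "l \<in> Omega0" "k \<le> 2" "r q l < 1"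
  shows "norm (C_rem k l x) \<le> norm l ^ k * (r q l)\<^sup>2 * inverse (1 - r q l)"
    and "q1 > 0 \<Longrightarrow> norm (C_rem k l x) < norm l ^ k * (r q l)\<^sup>2 * inverse (1 - r q l)"
proof -
  obtain c a b where c: "norm c = norm l powi (int k - 2) / 3" and ab: "norm a = 1" "norm b = 1"
    and C: "C_rem k l x = c * C_int a b l x"
    using rem_form[OF assms(1,2)] by metis
  have l: "norm l > 0" using Omega0_D assms(1) by simp
  have "norm (C_rem k l x) \<le> norm l powi (int k - 2) / 3 * (3 * (q1 * (exp (r q l) - 1)))"
    unfolding C norm_mult c using ab by (intro mult_left_mono norm_C_int_le assms) auto
  also have "\<dots> = norm l ^ k * (r q l * (exp (r q l) - 1))"
    using l by (simp add: power_int_diff r_eq)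
  finally have *: "norm (C_rem k l x) \<le> norm l ^ k * (r q l * (exp (r q l) - 1))" .
  have r0: "r q l \<ge> 0" by (simp add: r_eq q1_nonneg)
  have eq: "norm l ^ k * (r q l)\<^sup>2 * inverse (1 - r q l) = norm l ^ k * (r q l * (r q l * inverse (1 - r q l)))"
    by (simp add: power2_eq_square)
  show "norm (C_rem k l x) \<le> norm l ^ k * (r q l)\<^sup>2 * inverse (1 - r q l)"
    unfolding eq by (intro order_trans[OF *] mult_left_mono exp_minus_1_le assms) (use r0 in auto)
  assume "q1 > 0"
  then have r: "r q l > 0" using l by (simp add: r_eq)
  then show "norm (C_rem k l x) < norm l ^ k * (r q l)\<^sup>2 * inverse (1 - r q l)"
    unfolding eq using l by (intro le_less_trans[OF *] mult_strict_left_mono exp_minus_1_le assms) auto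
qed

lemma D_rem_bound:
  assumes "l \<in> Omega0" "k \<le> 2" "integrable lebesgue (\<lambda>t. (q t)\<^sup>2)"
  shows "norm (D_rem k l x) \<le> Lnorm 2 q * norm l powi (int k - 2) * delta l"
    and "Lnorm 2 q > 0 \<Longrightarrow> norm (D_rem k l x) < Lnorm 2 q * norm l powi (int k - 2) * delta l"
proof -
  obtain c a b where c: "norm c = norm l powi (int k - 2) / 3" and ab: "norm a = 1" "norm b = 1"
    and D: "D_rem k l x = c * D_int a b l x"
    using rem_form[OF assms(1,2)] by metis
  have l: "norm l > 0" using Omega0_D assms(1) by simp
  let ?B = "Lnorm 2 q * norm l powi (int k - 2) * delta l"
  have "norm (D_rem k l x) \<le> norm l powi (int k - 2) / 3 * (2 * (Lnorm 2 q * delta l))"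
    unfolding D norm_mult c D_int_def using ab
    by (intro mult_left_mono norm_kern_0_integral_le assms q_measurable) auto
  \<comment> \<open>The slack \<open>2 / 3\<close> makes the bound strict as soon as it is
    positive.\<close>
  then have *: "norm (D_rem k l x) \<le> 2 / 3 * ?B" by (simp add: mult_ac)
  have "?B \<ge> 0" by (auto simp: Lnorm_2 delta_def Bochner_Integration.integral_nonneg)
  then show "norm (D_rem k l x) \<le> ?B" using * by linarith
  assume "Lnorm 2 q > 0"
  then have "?B > 0" using l Omega0_D(5)[OF assms(1)] by (simp add: delta_def)
  then show "norm (D_rem k l x) < ?B" using * by linarith
qed

lemma expansions:
  assumes "l \<in> Omega0"
  shows "psi0 q l x = 1 + \<i> / (3 * l\<^sup>2) * of_real (LINT t:{x..}|lebesgue. q t) + C_rem 0 l x + D_rem 0 l x"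
    and "v0' q l x * exp (- (\<i> * l * zeta 0 * of_real x))
                = \<i> * l * zeta 0 - 1 / (3 * l) * of_real (LINT t:{x..}|lebesgue. q t) + C_rem 1 l x + D_rem 1 l x"
    and "v0'' q l x * exp (- (\<i> * l * zeta 0 * of_real x))
                = (\<i> * l * zeta 0)\<^sup>2 - \<i> / 3 * of_real (LINT t:{x..}|lebesgue. q t) + C_rem 2 l x + D_rem 2 l x"
proof -
  show "psi0 q l x = 1 + \<i> / (3 * l\<^sup>2) * of_real (LINT t:{x..}|lebesgue. q t) + C_rem 0 l x + D_rem 0 l x"
    unfolding psi0_eq_T[OF assms] T_combination_split[OF assms]
    by (simp add: C_rem_def D_rem_def C0_eq D0_eq algebra_simps add_divide_distrib)
  show "v0' q l x * exp (- (\<i> * l * zeta 0 * of_real x))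
                = \<i> * l * zeta 0 - 1 / (3 * l) * of_real (LINT t:{x..}|lebesgue. q t) + C_rem 1 l x + D_rem 1 l x"
    unfolding v0'_eq[OF assms] T_combination_split[OF assms]
    by (simp add: C_rem_def D_rem_def mult.assoc exp_add[symmetric]) (simp add: algebra_simps add_divide_distrib)
  show "v0'' q l x * exp (- (\<i> * l * zeta 0 * of_real x))
                = (\<i> * l * zeta 0)\<^sup>2 - \<i> / 3 * of_real (LINT t:{x..}|lebesgue. q t) + C_rem 2 l x + D_rem 2 l x"
    unfolding v0''_eq[OF assms] T_combination_split[OF assms]
    by (simp add: C_rem_def D_rem_def mult.assoc exp_add[symmetric]) (simp add: algebra_simps add_divide_distrib)
qed

end

text \<open>\<open>lim\<close> and \<open>vector_derivative\<close> are total, so convergence and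
  differentiability are asserted explicitly. Strict bounds are conditional because for
  \<open>q\<close> zero almost everywhere they would read \<open>0 < 0\<close>.\<close>

theorem theorem1p3:
  fixes a :: real and q :: "real \<Rightarrow> real"
  assumes "a > 0"
    and "q \<in> borel_measurable lebesgue"
    and "integrable lebesgue (\<lambda>x. \<bar>q x\<bar>\<^sup>2 * exp (2 * a * \<bar>x\<bar>))"
  shows "(\<forall>l\<in>Omega0. (\<forall>x. (\<lambda>n. psi_approx q l n x) \<longlonglongrightarrow> psi0 q l x)
            \<and> solves_psi_equation q l (psi0 q l))
    \<and> (\<forall>x. (\<lambda>l. psi0 q l x) analytic_on Omega0)
    \<and> (\<forall>l\<in>Omega0. \<forall>x. v0 q l differentiable (at x) \<and> v0' q l differentiable (at x))
    \<and> (\<exists>C D :: nat \<Rightarrow> complex \<Rightarrow> real \<Rightarrow> complex.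
          C 0 = C0 q \<and> D 0 = D0 q
        \<and> (\<forall>l\<in>Omega0. \<forall>x.
              psi0 q l x
                = 1 + \<i> / (3 * l\<^sup>2) * of_real (LINT t:{x..}|lebesgue. q t) + C 0 l x + D 0 l x
            \<and> v0' q l x * exp (- (\<i> * l * zeta 0 * of_real x))
                = \<i> * l * zeta 0 - 1 / (3 * l) * of_real (LINT t:{x..}|lebesgue. q t)
                  + C 1 l x + D 1 l x
            \<and> v0'' q l x * exp (- (\<i> * l * zeta 0 * of_real x))
                = (\<i> * l * zeta 0)\<^sup>2 - \<i> / 3 * of_real (LINT t:{x..}|lebesgue. q t)
                  + C 2 l x + D 2 l x)
        \<and> (\<forall>k\<le>2. \<forall>l\<in>Omega0. r q l < 1 \<longrightarrow> (\<forall>x.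
              norm (C k l x) \<le> norm l ^ k * (r q l)\<^sup>2 * inverse (1 - r q l)
            \<and> norm (D k l x) \<le> Lnorm 2 q * norm l powi (int k - 2) * delta l
            \<and> (\<not> (AE t in lebesgue. q t = 0) \<longrightarrow>
                  norm (C k l x) < norm l ^ k * (r q l)\<^sup>2 * inverse (1 - r q l)
                \<and> norm (D k l x) < Lnorm 2 q * norm l powi (int k - 2) * delta l))))"
proof -
  note int = integrable_weighted_square[OF assms]
  interpret integrable_potential q by standard (rule int)
  have pos: "q1 > 0" "Lnorm 2 q > 0" if "\<not> (AE t in lebesgue. q t = 0)"
    using Lnorm_pos[OF int that] by (simp_all add: Lnorm_1 q1_def)
  have rem_0: "C_rem 0 = C0 q" "D_rem 0 = D0 q"
    by (simp_all add: C_rem_def D_rem_def)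
  show ?thesis
  proof (intro conjI)
    show "\<forall>l\<in>Omega0. (\<forall>x. (\<lambda>n. psi_approx q l n x) \<longlonglongrightarrow> psi0 q l x) \<and> solves_psi_equation q l (psi0 q l)"
      using psi_approx_LIMSEQ(1) solves_psi_equation_psi0 by blast
    show "\<forall>x. (\<lambda>l. psi0 q l x) analytic_on Omega0"
      using analytic_psi0 by blast
    show "\<forall>l\<in>Omega0. \<forall>x. v0 q l differentiable (at x) \<and> v0' q l differentiable (at x)"
      using differentiableI_vector v0_has_vector_derivative v0'_has_vector_derivative by blast
  qed (rule exI[of _ C_rem], rule exI[of _ D_rem],
      intro conjI ballI allI impI rem_0 expansions C_rem_bound D_rem_bound int(2) pos; assumption)
qed

end
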